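(* There exists a constant $C>0$ depending only on $K$ and $\min_{s}\pi_s$ such that, for any estimators $\hat p_1,\dots,\hat p_K$ (built from $\mathcal{D}_n$) and any $u>0$, the randomized plug-in classifier $\hat g$ satisfies $$\mathbb{E}[\mathcal{U}(\hat g)]\le\frac{C}{\sqrt{N}}.$$
   Context: $(X,S,Y)$ is a random triple with distribution $\mathbb{P}$, $X\in\mathcal{X}\subset\mathbb{R}^d$, $S\in\{-1,1\}$, $Y\in[K]$, $\pi_s=\mathbb{P}(S=s)>0$. For a classifier $g:\mathcal{X}\times\{-1,1\}\to[K]$ (possibly using auxiliary independent randomness), its unfairness is $\mathcal{U}(g)=\max_{k\in[K]}|\mathbb{P}(g(X,S)=k\mid S=1)-\mathbb{P}(g(X,S)=k\mid S=-1)|$. Plug-in construction: $\mathcal{D}_n$ is a labeled i.i.d. sample from $\mathbb{P}$ from which arbitrary measurable estimators $\hat p_k:\mathcal{X}\times\{-1,1\}\to\mathbb{R}$, $k\in[K]$, are built. Independently, $\mathcal{D}'_N$ consists of $N$ i.i.d. copies of $(X,S)$; $N_s$ is the number of them with $S=s$, $\hat\pi_s=N_s/N$, and $X^s_1,\dots,X^s_{N_s}$ are the feature vectors with $S=s$. Fix $u>0$; let $(\zeta^s_{k,i})$ be i.i.d. Uniform$[0,u]$ variables independent of everything else, and set $\bar p_k(x,s,\zeta)=\hat p_k(x,s)+\zeta$. Let $\hat\lambda\in\mathbb{R}^K$ be a minimizer of $\lambda\mapsto\sum_{s\in\{-1,1\}}\frac1{N_s}\sum_{i=1}^{N_s}\max_{k\in[K]}\big(\hat\pi_s\bar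 p_k(X^s_i,s,\zeta^s_{k,i})-s\lambda_k\big)$. The classifier is $\hat g(x,s)=\arg\max_{k\in[K]}(\hat\pi_s\bar p_k(x,s,\zeta_k)-s\hat\lambda_k)$, where at each prediction $(\zeta_k)_{k\in[K]}$ are fresh i.i.d. Uniform$[0,u]$ variables independent of everything else (ties broken by a fixed rule). $\mathcal{U}(\hat g)$ is computed conditionally on $\mathcal{D}_n,\mathcal{D}'_N,(\zeta^s_{k,i})$, with probabilities taken over a new independent $(X,S)$ and the fresh $(\zeta_k)$; the outer expectation is over all the data and perturbations. *)

theory Defs
  imports "HOL-Probability.Probability"
begin

text \<open>Features X in R^d are represented as functions nat => real on the index set {..<d};
  the sensitive attribute S is an int in {-1,1}; the label Y is a nat in {1..K}.\<close>

definition XS_space :: "nat \<Rightarrow> ((nat \<Rightarrow> real) \<times> int) measure" where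
  "XS_space d = (PiM {..<d} (\<lambda>_. lborel)) \<Otimes>\<^sub>M count_space {-1, 1}"

definition XSY_space :: "nat \<Rightarrow> nat \<Rightarrow> (((nat \<Rightarrow> real) \<times> int) \<times> nat) measure" where
  "XSY_space d K = XS_space d \<Otimes>\<^sub>M count_space {1..K}"

definition unif :: "real \<Rightarrow> real measure" where
  "unif u = uniform_measure lborel {0..u}"

definition group_prob :: "(((nat \<Rightarrow> real) \<times> int) \<times> nat) measure \<Rightarrow> int \<Rightarrow> real" where
  "group_prob P s = measure P {w \<in> space P. snd (fst w) = s}"

text \<open>Indices j < N of the unlabeled sample with S_j = s, in increasing order;
  X^s_i is the feature of the i-th of them, N_s is their number.\<close>
definition grp_idx :: "nat \<Rightarrow> (nat \<Rightarrow> 'x \<times> int) \<Rightarrow> int \<Rightarrow> nat list" where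
  "grp_idx N D s = filter (\<lambda>j. snd (D j) = s) [0..<N]"

definition pihat :: "nat \<Rightarrow> (nat \<Rightarrow> 'x \<times> int) \<Rightarrow> int \<Rightarrow> real" where
  "pihat N D s = real (length (grp_idx N D s)) / real N"

definition argmax_fix :: "nat \<Rightarrow> (nat \<Rightarrow> real) \<Rightarrow> nat" where
  "argmax_fix K f = (LEAST k. k \<in> {1..K} \<and> (\<forall>j\<in>{1..K}. f j \<le> f k))"

text \<open>The empirical objective in lambda.  ph k x s = hat p_k(x,s);
  D = unlabeled sample D'_N; Z (s,k,i) = zeta^s_{k,i}.\<close>
definition fair_objective ::
  "nat \<Rightarrow> nat \<Rightarrow> (nat \<Rightarrow> 'x \<Rightarrow> int \<Rightarrow> real) \<Rightarrow> (nat \<Rightarrow> 'x \<times> int)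
    \<Rightarrow> (int \<times> nat \<times> nat \<Rightarrow> real) \<Rightarrow> (nat \<Rightarrow> real) \<Rightarrow> real" where
  "fair_objective K N ph D Z lam =
     (\<Sum>s\<in>{-1, 1}. (1 / real (length (grp_idx N D s))) *
        (\<Sum>i<length (grp_idx N D s).
           Max ((\<lambda>k. pihat N D s * (ph k (fst (D (grp_idx N D s ! i))) s + Z (s, k, i))
                     - of_int s * lam k) ` {1..K})))"

definition plugin_classifier ::
  "nat \<Rightarrow> nat \<Rightarrow> (nat \<Rightarrow> 'x \<Rightarrow> int \<Rightarrow> real) \<Rightarrow> (nat \<Rightarrow> 'x \<times> int)
    \<Rightarrow> (nat \<Rightarrow> real) \<Rightarrow> 'x \<Rightarrow> int \<Rightarrow> (nat \<Rightarrow> real) \<Rightarrow> nat" where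
  "plugin_classifier K N ph D lam x s zeta =
     argmax_fix K (\<lambda>k. pihat N D s * (ph k x s + zeta k) - of_int s * lam k)"

definition cond_class_prob ::
  "('x \<times> int) measure \<Rightarrow> real \<Rightarrow> nat \<Rightarrow> ('x \<Rightarrow> int \<Rightarrow> (nat \<Rightarrow> real) \<Rightarrow> nat)
    \<Rightarrow> int \<Rightarrow> nat \<Rightarrow> real" where
  "cond_class_prob Q u K g s k =
     measure (Q \<Otimes>\<^sub>M PiM {1..K} (\<lambda>_. unif u))
       {p \<in> space (Q \<Otimes>\<^sub>M PiM {1..K} (\<lambda>_. unif u)).
          snd (fst p) = s \<and> g (fst (fst p)) s (snd p) = k}
     / measure Q {p \<in> space Q. snd p = s}"

definition unfairness ::
  "('x \<times> int) measure \<Rightarrow> real \<Rightarrow> nat \<Rightarrow> ('x \<Rightarrow> int \<Rightarrow> (nat \<Rightarrow> real) \<Rightarrow> nat) \<Rightarrow> real" where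
  "unfairness Q u K g =
     Max ((\<lambda>k. \<bar>cond_class_prob Q u K g 1 k - cond_class_prob Q u K g (-1) k\<bar>) ` {1..K})"

text \<open>Full probability space: labeled sample D_n, unlabeled sample D'_N (law of (X,S)),
  and training perturbations zeta^s_{k,i}, (s,k,i) in {-1,1} x [K] x {..<N}.\<close>
definition Omega ::
  "nat \<Rightarrow> nat \<Rightarrow> nat \<Rightarrow> nat \<Rightarrow> real \<Rightarrow> (((nat \<Rightarrow> real) \<times> int) \<times> nat) measure
    \<Rightarrow> ((nat \<Rightarrow> ((nat \<Rightarrow> real) \<times> int) \<times> nat) \<times> (nat \<Rightarrow> (nat \<Rightarrow> real) \<times> int)
        \<times> (int \<times> nat \<times> nat \<Rightarrow> real)) measure" where
  "Omega d K n N u P =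
     PiM {..<n} (\<lambda>_. P) \<Otimes>\<^sub>M
       (PiM {..<N} (\<lambda>_. distr P (XS_space d) fst) \<Otimes>\<^sub>M
        PiM ({-1, 1} \<times> {1..K} \<times> {..<N}) (\<lambda>_. unif u))"

end

theory Submission
  imports Defs
begin

text \<open>
  Fix the labeled sample, so that the score functions are deterministic. For either group the event
  that the classifier predicts \<open>k\<close> is, up to ties, an orthant: all margins
  \<open>h_l = p_k + zeta_k - p_l - zeta_l\<close> exceed thresholds determined by \<open>lambda\<close>. The
  first-order optimality conditions of the empirical objective
  say that the empirical frequency of the strict orthant in one group is at most that of the weak
  orthant in the other. It remains to bound the uniform deviation between empirical and true
  probabilities of orthants by \<open>O(1 / sqrt N)\<close> in expectation. The uniform noise makes the margins
  atomless, so each margin can be cut at its dyadic quantiles. Chaining over the dyadic levels,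
  with an exponential-moment maximal inequality for sets of probability \<open>O(2 ^ - j)\<close> at level \<open>j\<close>,
  gives a convergent series and hence no logarithmic factor. At the finest level, of mesh
  \<open>O(1 / N)\<close>, weak and strict orthants lie between the same grid sets, so ties need no separate
  treatment.
\<close>

section \<open>Maximal inequality for empirical deviations\<close>

text \<open>The multiplier is an arbitrary function of the data, so each estimate has to hold at
  every outcome for all thresholds at once. Expectations are therefore bounded through measurable
  majorants chosen before the multiplier enters. Two mismatches separate the objective from an
  empirical process over an i.i.d. sample. The perturbations are numbered by rank within a group,
  and this rank is random; reattaching each of them to its sample point restores the i.i.d.
  structure. The empirical frequencies have random denominators N_s; since a whole group is the
  orthant with void thresholds, the same majorant controls N_s, and it also pays for the event that
  a group is empty. Replacing each margin by its cdf value removes the law of the scores from the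
  entropy count. Hence the constant sees neither the estimators nor \<open>u\<close>, only
  \<open>K\<close>, through the number \<open>K - 1\<close> of margins and the number of classes,
  and the smallest group probability, through the denominators.\<close>

text \<open>For non-measurable \<open>f\<close> the integral is a lower integral, so only this inequality of Tonelli's
  theorem survives.\<close>

lemma nn_integral_pair_le:
  assumes "sigma_finite_measure B"
  shows "(\<integral>\<^sup>+ z. f z \<partial>(A \<Otimes>\<^sub>M B)) \<le> (\<integral>\<^sup>+ x. \<integral>\<^sup>+ y. f (x, y) \<partial>B \<partial>A)"
proof -
  interpret sigma_finite_measure B by fact
  show ?thesis
    unfolding nn_integral_def[of "A \<Otimes>\<^sub>M B"]
  proof (intro SUP_least)
    fix g assume "g \<in> {g. simple_function (A \<Otimes>\<^sub>M B) g \<and> g \<le> f}"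
    then have g: "simple_function (A \<Otimes>\<^sub>M B) g" and gf: "\<And>z. g z \<le> f z"
      by (auto simp: le_fun_def)
    have "integral\<^sup>S (A \<Otimes>\<^sub>M B) g = (\<integral>\<^sup>+ z. g z \<partial>(A \<Otimes>\<^sub>M B))"
      using g by (simp add: nn_integral_eq_simple_integral)
    also have "\<dots> = (\<integral>\<^sup>+ x. \<integral>\<^sup>+ y. g (x, y) \<partial>B \<partial>A)"
      using g by (intro nn_integral_fst[symmetric] borel_measurable_simple_function)
    also have "\<dots> \<le> (\<integral>\<^sup>+ x. \<integral>\<^sup>+ y. f (x, y) \<partial>B \<partial>A)"
      by (intro nn_integral_mono gf)
    finally show "integral\<^sup>S (A \<Otimes>\<^sub>M B) g \<le> \<dots>" .
  qed
qed

text \<open>Left unnormalised, so that deviations are additive over disjoint sets and group counts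
  appear without a random denominator.\<close>

definition emp_dev :: "'a measure \<Rightarrow> nat \<Rightarrow> 'a set \<Rightarrow> (nat \<Rightarrow> 'a) \<Rightarrow> real" where
  "emp_dev R N A \<omega> = (\<Sum>j<N. indicator A (\<omega> j) - measure R A)"

lemma emp_dev_eq: "emp_dev R N A \<omega> = (\<Sum>j<N. indicator A (\<omega> j)) - real N * measure R A"
  by (simp add: emp_dev_def sum_subtractf)

lemma measurable_emp_dev [measurable]:
  assumes [measurable]: "A \<in> sets R"
  shows "emp_dev R N A \<in> borel_measurable (PiM {..<N} (\<lambda>_. R))"
  unfolding emp_dev_def by measurable

text \<open>Encodes that the expected supremum of the deviations over \<open>T\<close> is at most
  \<open>c\<close>. A measurable majorant is carried in place of the supremum: majorants of
  successive levels simply add, and the final one passes to uncountable families of orthants without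
  any discussion of measurable suprema.\<close>

definition dev_dominated :: "'a measure \<Rightarrow> nat \<Rightarrow> 'i set \<Rightarrow> ('i \<Rightarrow> 'a set) \<Rightarrow> real \<Rightarrow> bool" where
  "dev_dominated R N T A c \<longleftrightarrow>
    (\<exists>g\<in>borel_measurable (PiM {..<N} (\<lambda>_. R)). (\<forall>\<omega>. 0 \<le> g \<omega>) \<and>
      (\<forall>\<omega>. \<forall>r\<in>T. \<bar>emp_dev R N (A r) \<omega>\<bar> \<le> g \<omega>) \<and>
      (\<integral>\<^sup>+ \<omega>. ennreal (g \<omega>) \<partial>PiM {..<N} (\<lambda>_. R)) \<le> ennreal c)"

lemma dev_dominatedI:
  assumes "g \<in> borel_measurable (PiM {..<N} (\<lambda>_. R))" "\<And>\<omega>. 0 \<le> g \<omega>"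
    "\<And>\<omega> r. r \<in> T \<Longrightarrow> \<bar>emp_dev R N (A r) \<omega>\<bar> \<le> g \<omega>"
    "(\<integral>\<^sup>+ \<omega>. ennreal (g \<omega>) \<partial>PiM {..<N} (\<lambda>_. R)) \<le> ennreal c"
  shows "dev_dominated R N T A c"
  using assms unfolding dev_dominated_def by blast

lemma dev_dominated_mono: "dev_dominated R N T A c \<Longrightarrow> c \<le> c' \<Longrightarrow> dev_dominated R N T A c'"
  unfolding dev_dominated_def by (meson ennreal_leI order_trans)

section \<open>Exponential moments of a single deviation\<close>

lemma exp_le_quadratic:
  fixes x :: real
  assumes "\<bar>x\<bar> \<le> 1"
  shows "exp x \<le> 1 + x + x\<^sup>2"
proof (cases "x \<ge> 0")
  case True
  then show ?thesis using assms exp_bound by auto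
next
  case False
  define y where "y = - x"
  have y: "0 < y" "y \<le> 1" using False assms by (auto simp: y_def)
  have "1 + y \<le> exp y" by (rule exp_ge_add_one_self)
  then have "exp (- y) \<le> 1 / (1 + y)"
    using y by (simp add: exp_minus field_simps)
  also have "\<dots> \<le> 1 - y + y\<^sup>2"
  proof -
    have "(1 - y + y\<^sup>2) * (1 + y) = 1 + y ^ 3"
      by (simp add: algebra_simps power2_eq_square power3_eq_cube)
    also have "\<dots> \<ge> 1" using y by simp
    finally show ?thesis using y by (simp add: field_simps)
  qed
  finally show ?thesis by (simp add: y_def)
qed

text \<open>An indicator has two values, so its exponential is affine in it and the expectation is
  explicit; then 1 + x <= exp x. The exponent keeps the factor \<open>prob A\<close>, as in
  Bernstein's inequality: a Hoeffding bound would ignore that the sets of fine levels have small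
  probability, and the chaining sum would diverge.\<close>

lemma (in prob_space) expectation_exp_centered_indicator_le:
  assumes A: "A \<in> events" and c: "\<bar>c\<bar> \<le> 1"
  shows "(\<integral>\<^sup>+ x. ennreal (exp (c * (indicator A x - prob A))) \<partial>M) \<le> ennreal (exp (prob A * c\<^sup>2))"
proof -
  let ?p = "prob A"
  have [measurable]: "A \<in> sets M" by fact
  have eq: "exp (c * (indicator A x - ?p)) = exp (- c * ?p) * (1 + (exp c - 1) * indicator A x)" for x
    by (auto simp: indicator_def exp_diff exp_minus algebra_simps divide_inverse)
  have int: "integrable M (\<lambda>x. exp (- c * ?p) * (1 + (exp c - 1) * indicator A x))"
    by (intro integrable_mult_right Bochner_Integration.integrable_add integrable_const integrable_real_indicator A)
      (simp add: emeasure_eq_measure)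
  have "(\<integral>\<^sup>+ x. ennreal (exp (c * (indicator A x - ?p))) \<partial>M)
      = ennreal (\<integral> x. exp (- c * ?p) * (1 + (exp c - 1) * indicator A x) \<partial>M)"
    unfolding eq
    by (intro nn_integral_eq_integral int AE_I2) (simp only: eq[symmetric] exp_ge_zero)
  also have "(\<integral> x. exp (- c * ?p) * (1 + (exp c - 1) * indicator A x) \<partial>M)
      = exp (- c * ?p) * (1 + (exp c - 1) * ?p)"
    by (simp add: prob_space emeasure_eq_measure)
  also have "\<dots> \<le> exp (- c * ?p) * exp ((exp c - 1) * ?p)"
    by (intro mult_left_mono exp_ge_add_one_self) auto
  also have "\<dots> = exp (?p * (exp c - 1 - c))"
    by (simp add: exp_add[symmetric] algebra_simps)
  also have "\<dots> \<le> exp (?p * c\<^sup>2)"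
    using exp_le_quadratic[OF c] by (simp add: mult_left_mono)
  finally show ?thesis by (simp add: ennreal_leI)
qed

lemma (in prob_space) emp_dev_mgf:
  assumes A: "A \<in> events" and c: "\<bar>c\<bar> \<le> 1"
  shows "(\<integral>\<^sup>+ \<omega>. ennreal (exp (c * emp_dev M N A \<omega>)) \<partial>PiM {..<N} (\<lambda>_. M))
      \<le> ennreal (exp (N * prob A * c\<^sup>2))"
proof -
  interpret P: product_sigma_finite "\<lambda>_::nat. M" by standard
  have [measurable]: "A \<in> sets M" by fact
  have "(\<integral>\<^sup>+ \<omega>. ennreal (exp (c * emp_dev M N A \<omega>)) \<partial>PiM {..<N} (\<lambda>_. M))
      = (\<integral>\<^sup>+ \<omega>. (\<Prod>j<N. ennreal (exp (c * (indicator A (\<omega> j) - prob A)))) \<partial>PiM {..<N} (\<lambda>_. M))"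
    by (simp add: emp_dev_def sum_distrib_left exp_sum prod_ennreal)
  also have "\<dots> = (\<Prod>j<N. \<integral>\<^sup>+ x. ennreal (exp (c * (indicator A x - prob A))) \<partial>M)"
    by (intro P.product_nn_integral_prod) auto
  also have "\<dots> \<le> (\<Prod>j<N. ennreal (exp (prob A * c\<^sup>2)))"
    by (intro prod_mono_ennreal expectation_exp_centered_indicator_le A c)
  also have "\<dots> = ennreal (exp (N * prob A * c\<^sup>2))"
    by (simp add: prod_ennreal ennreal_power exp_of_nat_mult[symmetric] mult.assoc)
  finally show ?thesis .
qed

text \<open>The inequality y <= exp y, applied to y = t * |x| - v, bounds every deviation by
  \<open>v / t\<close> plus an exponential term, and the sum of these terms over \<open>T\<close>
  dominates their maximum. This replaces the usual detour through Jensen's inequality and a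
  logarithm, and makes the majorant an explicit measurable function.\<close>

lemma (in prob_space) emp_dev_maximal:
  fixes A :: "'i \<Rightarrow> 'a set"
  assumes T: "finite T" and A: "\<And>r. r \<in> T \<Longrightarrow> A r \<in> events"
    and p: "\<And>r. r \<in> T \<Longrightarrow> prob (A r) \<le> p" "0 \<le> p"
    and t: "0 < t" "t \<le> 1" and b: "2 * real (card T) \<le> exp b" "0 \<le> b"
  shows "dev_dominated M N T A ((1 + b + N * p * t\<^sup>2) / t)"
proof -
  let ?P = "PiM {..<N} (\<lambda>_. M)"
  interpret P: prob_space ?P by (intro prob_space_PiM) unfold_locales
  \<comment> \<open>With this offset, \<open>exp (- v)\<close> cancels the moment bound
    \<open>exp (N * p * t^2)\<close> and leaves \<open>exp (- b)\<close>, which pays for the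
    \<open>2 * card T\<close> exponentials.\<close>
  define v where "v = b + N * p * t\<^sup>2"
  have v: "0 \<le> v" using p b by (simp add: v_def)
  let ?D = "\<lambda>r \<omega>. emp_dev M N (A r) \<omega>"
  define g where "g \<omega> = v / t + (\<Sum>r\<in>T. (exp (- v) * exp (t * ?D r \<omega>) + exp (- v) * exp (- t * ?D r \<omega>)) / t)" for \<omega>
  note A[measurable]
  show ?thesis
  proof (rule dev_dominatedI)
    show meas: "g \<in> borel_measurable ?P"
      unfolding g_def by measurable
    show "0 \<le> g \<omega>" for \<omega>
      unfolding g_def using v t by (intro add_nonneg_nonneg sum_nonneg divide_nonneg_nonneg) auto
    show "\<bar>?D r \<omega>\<bar> \<le> g \<omega>" if r: "r \<in> T" for \<omega> r
    proof -
      let ?x = "?D r \<omega>"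
      have "t * \<bar>?x\<bar> - v \<le> exp (t * \<bar>?x\<bar> - v)"
        using exp_ge_add_one_self[of "t * \<bar>?x\<bar> - v"] by linarith
      also have "\<dots> = exp (- v) * exp (t * \<bar>?x\<bar>)"
        by (simp add: exp_add[symmetric])
      also have "\<dots> \<le> exp (- v) * exp (t * ?x) + exp (- v) * exp (- t * ?x)"
        by (cases "?x \<ge> 0") auto
      finally have "\<bar>?x\<bar> \<le> v / t + (exp (- v) * exp (t * ?x) + exp (- v) * exp (- t * ?x)) / t"
        using t by (simp add: field_simps)
      also have "\<dots> \<le> g \<omega>"
        unfolding g_def using t
        by (intro add_left_mono member_le_sum r T divide_nonneg_nonneg add_nonneg_nonneg) auto
      finally show ?thesis .
    qed
    have summand: "(\<integral>\<^sup>+ \<omega>. ennreal ((exp (- v) * exp (t * ?D r \<omega>) + exp (- v) * exp (- t * ?D r \<omega>)) / t) \<partial>?P)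
        \<le> ennreal (2 * exp (- b) / t)" if r: "r \<in> T" for r
    proof -
      have le: "(\<integral>\<^sup>+ \<omega>. ennreal (exp (c * ?D r \<omega>)) \<partial>?P) \<le> ennreal (exp (N * p * t\<^sup>2))"
        if c: "c = t \<or> c = - t" for c
      proof -
        have "(\<integral>\<^sup>+ \<omega>. ennreal (exp (c * ?D r \<omega>)) \<partial>?P) \<le> ennreal (exp (N * prob (A r) * c\<^sup>2))"
          using c t by (intro emp_dev_mgf A r) auto
        also have "\<dots> \<le> ennreal (exp (N * p * t\<^sup>2))"
          using c p(1)[OF r] by (auto intro!: ennreal_leI mult_right_mono mult_left_mono)
        finally show ?thesis .
      qed
      have "(\<integral>\<^sup>+ \<omega>. ennreal ((exp (- v) * exp (t * ?D r \<omega>) + exp (- v) * exp (- t * ?D r \<omega>)) / t) \<partial>?P)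
        = (\<integral>\<^sup>+ \<omega>. ennreal (exp (- v) / t) * ennreal (exp (t * ?D r \<omega>)) +
                  ennreal (exp (- v) / t) * ennreal (exp (- t * ?D r \<omega>)) \<partial>?P)"
        using t by (intro nn_integral_cong)
          (auto simp: ennreal_mult'[symmetric] ennreal_plus[symmetric] field_simps simp del: ennreal_plus)
      also have "\<dots> = ennreal (exp (- v) / t) * (\<integral>\<^sup>+ \<omega>. ennreal (exp (t * ?D r \<omega>)) \<partial>?P)
          + ennreal (exp (- v) / t) * (\<integral>\<^sup>+ \<omega>. ennreal (exp (- t * ?D r \<omega>)) \<partial>?P)"
        using r by (subst nn_integral_add) (auto simp: nn_integral_cmult)
      also have "\<dots> \<le> ennreal (exp (- v) / t) * ennreal (exp (N * p * t\<^sup>2))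
          + ennreal (exp (- v) / t) * ennreal (exp (N * p * t\<^sup>2))"
        by (intro add_mono mult_left_mono le) auto
      also have "\<dots> = ennreal (2 * exp (- b) / t)"
        using t by (simp add: ennreal_mult'[symmetric] ennreal_plus[symmetric] v_def exp_diff exp_minus
            exp_add field_simps del: ennreal_plus)
      finally show ?thesis .
    qed
    have nn: "0 \<le> (exp (- v) * exp (t * ?D r \<omega>) + exp (- v) * exp (- t * ?D r \<omega>)) / t" for r \<omega>
      using t by simp
    have "(\<integral>\<^sup>+ \<omega>. ennreal (g \<omega>) \<partial>?P) = (\<integral>\<^sup>+ \<omega>. ennreal (v / t) +
        (\<Sum>r\<in>T. ennreal ((exp (- v) * exp (t * ?D r \<omega>) + exp (- v) * exp (- t * ?D r \<omega>)) / t)) \<partial>?P)"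
      unfolding g_def using v t nn
      by (subst sum_ennreal) (auto intro!: nn_integral_cong ennreal_plus sum_nonneg)
    also have "\<dots> = ennreal (v / t) + (\<Sum>r\<in>T. \<integral>\<^sup>+ \<omega>. ennreal ((exp (- v) * exp (t * ?D r \<omega>)
        + exp (- v) * exp (- t * ?D r \<omega>)) / t) \<partial>?P)"
      by (subst nn_integral_add) (auto simp: nn_integral_sum P.emeasure_space_1)
    also have "\<dots> \<le> ennreal (v / t) + (\<Sum>r\<in>T. ennreal (2 * exp (- b) / t))"
      by (intro add_left_mono sum_mono summand)
    also have "\<dots> = ennreal (v / t + card T * (2 * exp (- b) / t))"
      using t v by (simp add: ennreal_of_nat_eq_real_of_nat ennreal_mult'[symmetric])
    also have "\<dots> \<le> ennreal ((1 + b + N * p * t\<^sup>2) / t)"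
    proof (rule ennreal_leI)
      have "2 * real (card T) * exp (- b) \<le> exp b * exp (- b)"
        using b(1) by (intro mult_right_mono) auto
      also have "\<dots> = 1" by (simp add: exp_minus)
      finally have "2 * real (card T) * exp (- b) / t \<le> 1 / t"
        using t by (intro divide_right_mono) auto
      then show "v / t + card T * (2 * exp (- b) / t) \<le> (1 + b + N * p * t\<^sup>2) / t"
        by (simp add: v_def add_divide_distrib mult_ac)
    qed
    finally show "(\<integral>\<^sup>+ \<omega>. ennreal (g \<omega>) \<partial>?P) \<le> ennreal ((1 + b + N * p * t\<^sup>2) / t)" .
  qed
qed

section \<open>Chaining over a quantile grid\<close>

lemma (in real_distribution) borel_measurable_cdf: "cdf M \<in> borel_measurable borel"
  by (intro borel_measurable_mono monoI cdf_nondecreasing)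

text \<open>For an atomless law the cdf value is uniform on [0, 1]. It suffices to compute the law
  of the events \<open>cdf M x < c\<close> and subtract two of them.\<close>

lemma (in real_distribution) measure_cdf_strip:
  assumes atomless: "\<And>x. prob {x} = 0" and "0 \<le> a" "a \<le> b"
  shows "prob {x. a \<le> cdf M x \<and> cdf M x < b} \<le> b - a"
proof -
  have cont: "isCont (cdf M) x" for x
    using atomless by (simp add: isCont_cdf)
  have [measurable]: "cdf M \<in> borel_measurable borel"
    by (rule borel_measurable_cdf)
  have cdf_lt: "prob {x. cdf M x < c} = min c 1" if "0 \<le> c" for c
  proof -
    consider "c = 0" | "c > 0" "\<exists>y. cdf M y \<ge> c" | "c > 0" "\<And>y. cdf M y < c"
      using \<open>0 \<le> c\<close> by (metis less_eq_real_def not_le)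
    then show ?thesis
    proof cases
      case 1
      then have "{x. cdf M x < c} = {}" using cdf_nonneg by (auto simp: not_less)
      then show ?thesis using 1 by simp
    next
      case 2
      obtain y where y: "cdf M y \<ge> c" using 2 by blast
      have "eventually (\<lambda>x. cdf M x < c) at_bot"
        using cdf_lim_at_bot 2 by (simp add: order_tendstoD)
      then obtain x where x: "cdf M x < c" "x \<le> y"
        by (auto simp: eventually_at_bot_linorder) (metis min.cobounded1 min.cobounded2)
      obtain z where z: "cdf M z = c"
        using IVT[of "cdf M" x c y] x y cont by auto
      \<comment> \<open>The leftmost \<open>c\<close>-quantile. The cdf may be flat at height
        \<open>c\<close>, and the event \<open>cdf M x < c\<close> stops at the left end of the flat
        piece.\<close>
      define w where "w = Inf {z. c \<le> cdf M z}"
      have bdd: "bdd_below {z. c \<le> cdf M z}"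
      proof (rule bdd_belowI[of _ x])
        fix v assume "v \<in> {z. c \<le> cdf M z}"
        then show "x \<le> v" using x cdf_nondecreasing[of v x] by (cases "x \<le> v") auto
      qed
      have clo: "closed {z. c \<le> cdf M z}"
        using cont by (intro closed_Collect_le continuous_intros continuous_at_imp_continuous_on) auto
      have w_in: "c \<le> cdf M w"
        using closed_contains_Inf[OF _ bdd clo] z unfolding w_def by auto
      have "w \<le> z" unfolding w_def using z bdd by (intro cInf_lower) auto
      then have "cdf M w = c" using w_in z cdf_nondecreasing[of w z] by auto
      have "{x. cdf M x < c} = {..<w}"
      proof (intro set_eqI iffI; simp)
        fix v assume "cdf M v < c"
        then show "v < w" using w_in cdf_nondecreasing[of w v] by (cases "v < w") auto
      next
        fix v assume "v < w"
        then have "\<not> c \<le> cdf M v" using cInf_lower[OF _ bdd, of v] by (auto simp: w_def)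
        then show "cdf M v < c" by simp
      qed
      moreover have "prob {..w} = prob {..<w} + prob {w}"
        by (subst finite_measure_Union[symmetric]) (auto intro!: arg_cong[where f=prob])
      ultimately have "prob {x. cdf M x < c} = c"
        using \<open>cdf M w = c\<close> atomless by (simp add: cdf_def)
      moreover have "c \<le> 1" using \<open>cdf M w = c\<close> cdf_bounded_prob by metis
      ultimately show ?thesis by simp
    next
      \<comment> \<open>The cdf stays below \<open>c\<close> although it tends to 1, which forces
        \<open>1 <= c\<close>.\<close>
      case 3
      then have "{x. cdf M x < c} = space M" by (auto simp: borel_UNIV)
      moreover have "1 \<le> c"
        using 3 by (intro tendsto_upperbound[OF cdf_lim_at_top_prob]) (auto intro: always_eventually less_imp_le)
      ultimately show ?thesis using prob_space by simp
    qed
  qed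
  have "{x. a \<le> cdf M x \<and> cdf M x < b} = {x. cdf M x < b} - {x. cdf M x < a}"
    by auto
  then have "prob {x. a \<le> cdf M x \<and> cdf M x < b} = prob {x. cdf M x < b} - prob {x. cdf M x < a}"
    using assms by (simp, subst finite_measure_Diff) (auto simp: borel_UNIV)
  also have "\<dots> \<le> b - a" using assms by (simp add: cdf_lt)
  finally show ?thesis .
qed

text \<open>Orthants rather than cells of a partition, so that sets of different levels are nested.
  The functions \<open>V l\<close> stand for cdf values of the margins, which turns the dyadic
  thresholds into quantiles.\<close>

definition grid_set :: "'a set \<Rightarrow> 'l set \<Rightarrow> ('l \<Rightarrow> 'a \<Rightarrow> real) \<Rightarrow> nat \<Rightarrow> ('l \<Rightarrow> nat) \<Rightarrow> 'a set" where
  "grid_set A0 L V j r = {x \<in> A0. \<forall>l\<in>L. real (r l) / 2 ^ j \<le> V l x}"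

text \<open>The last index lies one step beyond the threshold 1: a cdf value equal to 1 rounds down
  to \<open>2 ^ j\<close>, and the inner approximation of an orthant uses the next index.\<close>

definition grid_index :: "'l set \<Rightarrow> nat \<Rightarrow> ('l \<Rightarrow> nat) set" where
  "grid_index L j = (L \<rightarrow>\<^sub>E {..2 ^ j + 1})"

text \<open>Cost of level \<open>j\<close> divided by \<open>sqrt N\<close>, where \<open>d\<close>
  counts the margins, not the features. The maximal inequality with b = 1 + d * (j + 2), sets of
  probability (d + 1) / 2 ^ j and t = sqrt (2 ^ j / N) yields 3 + d * (j + 3) times the power; the 4
  is slack. The logarithm of the grid size grows linearly in \<open>j\<close> while the scale decays
  geometrically, so the series converges.\<close>

definition chain_term :: "nat \<Rightarrow> nat \<Rightarrow> real" where
  "chain_term d j = (3 + real d * (real j + 4)) * (1 / sqrt 2) ^ j"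

definition chain_const :: "nat \<Rightarrow> real" where
  "chain_const d = (\<Sum>j. chain_term d j)"

lemma chain_term_nonneg: "0 \<le> chain_term d j"
  by (simp add: chain_term_def)

lemma summable_chain_term: "summable (chain_term d)"
proof -
  let ?q = "1 / sqrt 2 :: real"
  have q: "norm ?q < 1" by (simp add: real_less_rsqrt)
  have "summable (\<lambda>j. real (Suc j) * ?q ^ j)"
    using geometric_deriv_sums[OF q] by (simp add: sums_iff)
  then have "summable (\<lambda>j. real d * (real (Suc j) * ?q ^ j) + (3 + 3 * real d) * ?q ^ j)"
    by (intro summable_add summable_mult summable_geometric q)
  also have "(\<lambda>j. real d * (real (Suc j) * ?q ^ j) + (3 + 3 * real d) * ?q ^ j) = chain_term d"
    by (auto simp: chain_term_def fun_eq_iff algebra_simps)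
  finally show ?thesis .
qed

lemma sum_chain_term_le: "(\<Sum>j\<le>J. chain_term d j) \<le> chain_const d"
  unfolding chain_const_def
  by (intro sum_le_suminf summable_chain_term) (auto simp: chain_term_nonneg)

lemma chain_const_nonneg: "0 \<le> chain_const d"
  unfolding chain_const_def by (intro suminf_nonneg summable_chain_term chain_term_nonneg)

lemma finite_grid_index: "finite L \<Longrightarrow> finite (grid_index L j)"
  unfolding grid_index_def by (intro finite_PiE) auto

lemma card_grid_index_le:
  assumes "finite L"
  shows "2 * real (card (grid_index L j)) \<le> exp (real (1 + card L * (j + 2)))"
proof -
  have "real (card (grid_index L j)) = real (2 ^ j + 2) ^ card L"
    using assms by (simp add: grid_index_def card_PiE)
  also have "\<dots> \<le> real (2 ^ (j + 2)) ^ card L"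
    using one_le_power[of "2::real" j] by (intro power_mono) (auto simp del: one_le_power)
  also have "\<dots> = 2 ^ (card L * (j + 2))"
    by (simp only: of_nat_power of_nat_numeral power_mult mult.commute[of "card L" "j + 2"])
  finally have "2 * real (card (grid_index L j)) \<le> 2 ^ (1 + card L * (j + 2))"
    by simp
  also have "\<dots> \<le> exp 1 ^ (1 + card L * (j + 2))"
    using exp_ge_add_one_self[of "1::real"] by (intro power_mono) auto
  also have "\<dots> = exp (real (1 + card L * (j + 2)))"
    by (simp only: exp_of_nat_mult[symmetric] mult_1_right)
  finally show ?thesis .
qed

context prob_space
begin

lemma sets_grid_set [measurable]:
  assumes "A0 \<in> events" "finite L" "\<And>l. l \<in> L \<Longrightarrow> V l \<in> borel_measurable M"
  shows "grid_set A0 L V j r \<in> events"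
proof -
  note assms[measurable]
  have "grid_set A0 L V j r = {x \<in> space M. x \<in> A0 \<and> (\<forall>l\<in>L. real (r l) / 2 ^ j \<le> V l x)}"
    using sets.sets_into_space[OF assms(1)] by (auto simp: grid_set_def)
  also have "\<dots> \<in> events" using assms(2) by measurable
  finally show ?thesis .
qed

text \<open>A point lost in the passage from \<open>q\<close> to \<open>r\<close> violates some
  threshold of \<open>r\<close> and lies in a strip of width at most \<open>1 / 2 ^ j\<close>; the
  union bound contributes the factor \<open>card L\<close>. Two levels are allowed because the lemma
  serves both a link of the chain (\<open>i\<close> one below \<open>j\<close>) and the gap between
  neighbouring grid sets (\<open>i = j\<close>).\<close>

lemma prob_grid_set_diff_le:
  assumes A0: "A0 \<in> events" and L: "finite L" and V: "\<And>l. l \<in> L \<Longrightarrow> V l \<in> borel_measurable M"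
    and strip: "\<And>l a b. l \<in> L \<Longrightarrow> 0 \<le> a \<Longrightarrow> a \<le> b \<Longrightarrow> prob {x \<in> space M. a \<le> V l x \<and> V l x < b} \<le> b - a"
    and q: "\<And>l. l \<in> L \<Longrightarrow> real (q l) / 2 ^ i \<le> real (r l) / 2 ^ j"
      "\<And>l. l \<in> L \<Longrightarrow> real (r l) / 2 ^ j - real (q l) / 2 ^ i \<le> 1 / 2 ^ j"
  shows "prob (grid_set A0 L V i q - grid_set A0 L V j r) \<le> card L / 2 ^ j"
proof -
  let ?S = "\<lambda>l. {x \<in> space M. real (q l) / 2 ^ i \<le> V l x \<and> V l x < real (r l) / 2 ^ j}"
  note V[measurable]
  have "prob (grid_set A0 L V i q - grid_set A0 L V j r) \<le> prob (\<Union>l\<in>L. ?S l)"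
  proof (rule finite_measure_mono)
    show "grid_set A0 L V i q - grid_set A0 L V j r \<subseteq> (\<Union>l\<in>L. ?S l)"
      using sets.sets_into_space[OF A0] by (auto simp: grid_set_def not_le)
    show "(\<Union>l\<in>L. ?S l) \<in> events"
      using L by (intro sets.finite_UN) measurable
  qed
  also have "\<dots> \<le> (\<Sum>l\<in>L. prob (?S l))"
  proof (rule finite_measure_subadditive_finite[OF L])
    show "?S ` L \<subseteq> events" by (intro image_subsetI) measurable
  qed
  also have "\<dots> \<le> (\<Sum>l\<in>L. 1 / 2 ^ j)"
  proof (intro sum_mono)
    fix l assume l: "l \<in> L"
    show "prob (?S l) \<le> 1 / 2 ^ j"
      using strip[OF l _ q(1)[OF l]] q(2)[OF l] by (intro order_trans[OF strip[OF l _ q(1)[OF l]]]) auto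
  qed
  finally show ?thesis by simp
qed

text \<open>One level of the chain costs \<open>sqrt N\<close> times \<open>chain_term\<close>: the maximal inequality is
  applied to sets of probability \<open>O(2 ^ - j)\<close> with \<open>t = sqrt (2 ^ j / N)\<close>.\<close>

lemma emp_dev_level:
  fixes A :: "('l \<Rightarrow> nat) \<Rightarrow> 'a set"
  assumes L: "finite L" and A: "\<And>r. r \<in> grid_index L j \<Longrightarrow> A r \<in> events"
    and p: "\<And>r. r \<in> grid_index L j \<Longrightarrow> prob (A r) \<le> real (card L + 1) / 2 ^ j"
    and N: "2 ^ j \<le> N"
  shows "dev_dominated M N (grid_index L j) A (sqrt N * chain_term (card L) j)"
proof -
  define t where "t = sqrt 2 ^ j / sqrt N"
  have N0: "0 < N" using N by (metis gr0I le_zero_eq power_not_zero zero_neq_numeral)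
  have N': "2 ^ j \<le> real N" using N by (metis of_nat_le_iff of_nat_numeral of_nat_power)
  have t2: "t\<^sup>2 = 2 ^ j / N"
    using N0 by (simp add: t_def power_divide power_mult[symmetric] mult.commute[of j])
      (simp add: power_mult)
  have t: "0 < t" "t \<le> 1"
    using N0 N' by (auto simp: t_def real_sqrt_power[symmetric] real_sqrt_le_iff)
  let ?b = "real (1 + card L * (j + 2))" and ?p = "real (card L + 1) / 2 ^ j"
  have "N * ?p * t\<^sup>2 = real (card L) + 1"
    using N0 by (simp add: t2)
  then have "(1 + ?b + N * ?p * t\<^sup>2) / t = (3 + real (card L) * (real j + 3)) / t"
    by (simp add: algebra_simps)
  also have "\<dots> = sqrt N * (3 + real (card L) * (real j + 3)) * (1 / sqrt 2) ^ j"
    by (simp add: t_def power_divide)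
  also have "\<dots> \<le> sqrt N * chain_term (card L) j"
    unfolding chain_term_def mult.assoc
    by (intro mult_left_mono mult_right_mono add_left_mono) (auto intro!: mult_left_mono)
  finally have le: "(1 + ?b + N * ?p * t\<^sup>2) / t \<le> sqrt N * chain_term (card L) j" .
  have p0: "0 \<le> ?p" and b0: "0 \<le> ?b" by simp_all
  show ?thesis
    by (rule dev_dominated_mono[OF emp_dev_maximal[OF finite_grid_index[OF L] A p p0 t card_grid_index_le[OF L] b0] le])
qed

text \<open>Every orthant of the finer grid is its parent minus a thin difference, and deviations
  are additive along this decomposition. One level therefore adds to the majorant only the maximal
  deviation of the differences. The bound \<open>2 ^ J <= N\<close> keeps the exponential parameter
  of each level at most 1.\<close>

lemma emp_dev_chaining:
  assumes A0: "A0 \<in> events" and L: "finite L" and V: "\<And>l. l \<in> L \<Longrightarrow> V l \<in> borel_measurable M"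
    and strip: "\<And>l a b. l \<in> L \<Longrightarrow> 0 \<le> a \<Longrightarrow> a \<le> b \<Longrightarrow> prob {x \<in> space M. a \<le> V l x \<and> V l x < b} \<le> b - a"
    and N: "2 ^ J \<le> N"
  shows "dev_dominated M N (grid_index L J) (grid_set A0 L V J) (sqrt N * (\<Sum>j\<le>J. chain_term (card L) j))"
  using N
proof (induction J)
  case 0
  have "prob (grid_set A0 L V 0 r) \<le> real (card L + 1) / 2 ^ 0" for r
    by (rule order_trans[OF prob_le_1]) simp
  then show ?case
    using emp_dev_level[OF L sets_grid_set[where V = V, OF A0 L V] _ 0] by simp
next
  case (Suc J)
  let ?B = "grid_set A0 L V" and ?P = "PiM {..<N} (\<lambda>_. M)"
  have "2 ^ J \<le> N" using Suc.prems by simp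
  from Suc.IH[OF this] obtain g where g [measurable]: "g \<in> borel_measurable ?P"
    and g0: "\<And>\<omega>. 0 \<le> g \<omega>"
    and gr: "\<And>\<omega> r. r \<in> grid_index L J \<Longrightarrow> \<bar>emp_dev M N (?B J r) \<omega>\<bar> \<le> g \<omega>"
    and gi: "(\<integral>\<^sup>+ \<omega>. ennreal (g \<omega>) \<partial>?P) \<le> ennreal (sqrt N * (\<Sum>j\<le>J. chain_term (card L) j))"
    unfolding dev_dominated_def by blast
  \<comment> \<open>The parent rounds each threshold down to the coarser grid, a move of at most one
    fine mesh width.\<close>
  define h where "h r = (\<lambda>l\<in>L. r l div 2)" for r :: "'b \<Rightarrow> nat"
  have h: "h r \<in> grid_index L J" if "r \<in> grid_index L (Suc J)" for r
    using that by (fastforce simp: h_def grid_index_def PiE_iff)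
  have hle: "real (h r l) / 2 ^ J \<le> real (r l) / 2 ^ Suc J"
    and hge: "real (r l) / 2 ^ Suc J - real (h r l) / 2 ^ J \<le> 1 / 2 ^ Suc J" if "l \<in> L" for r l
  proof -
    have "2 * (r l div 2) \<le> r l" "r l \<le> 2 * (r l div 2) + 1" by auto
    then have *: "2 * real (r l div 2) \<le> real (r l)" "real (r l) - 2 * real (r l div 2) \<le> 1"
      by linarith+
    have eq: "real (h r l) / 2 ^ J = 2 * real (r l div 2) / 2 ^ Suc J"
      using that by (simp add: h_def)
    show "real (h r l) / 2 ^ J \<le> real (r l) / 2 ^ Suc J"
      unfolding eq using * by (intro divide_right_mono) simp_all
    show "real (r l) / 2 ^ Suc J - real (h r l) / 2 ^ J \<le> 1 / 2 ^ Suc J"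
      unfolding eq diff_divide_distrib[symmetric] using * by (intro divide_right_mono) simp_all
  qed
  have sub: "?B (Suc J) r \<subseteq> ?B J (h r)" for r
    unfolding grid_set_def using order_trans[OF hle] by blast
  let ?D = "\<lambda>r. ?B J (h r) - ?B (Suc J) r"
  have D: "?D r \<in> events" for r
    using sets_grid_set[where V = V, OF A0 L V] by blast
  have "prob (?D r) \<le> real (card L + 1) / 2 ^ Suc J" for r
    using prob_grid_set_diff_le[where V = V and q = "h r" and r = r, OF A0 L V strip hle hge]
    by (rule order_trans) (auto intro: divide_right_mono)
  from emp_dev_level[where A = ?D, OF L D this Suc.prems] obtain g' where g' [measurable]: "g' \<in> borel_measurable ?P"
    and g'0: "\<And>\<omega>. 0 \<le> g' \<omega>"
    and g'r: "\<And>\<omega> r. r \<in> grid_index L (Suc J) \<Longrightarrow> \<bar>emp_dev M N (?D r) \<omega>\<bar> \<le> g' \<omega>"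
    and g'i: "(\<integral>\<^sup>+ \<omega>. ennreal (g' \<omega>) \<partial>?P) \<le> ennreal (sqrt N * chain_term (card L) (Suc J))"
    unfolding dev_dominated_def by blast
  show ?case
  proof (rule dev_dominatedI[of "\<lambda>\<omega>. g \<omega> + g' \<omega>"])
    fix \<omega> r assume r: "r \<in> grid_index L (Suc J)"
    have ind: "indicator (?D r) x = (indicator (?B J (h r)) x - indicator (?B (Suc J) r) x :: real)" for x
      using sub[of r] by (auto simp: indicator_def)
    have "emp_dev M N (?D r) \<omega> = emp_dev M N (?B J (h r)) \<omega> - emp_dev M N (?B (Suc J) r) \<omega>"
      using sub[of r] sets_grid_set[where V = V, OF A0 L V]
      by (simp add: emp_dev_def ind finite_measure_Diff sum_subtractf algebra_simps sum.distrib)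
    then show "\<bar>emp_dev M N (?B (Suc J) r) \<omega>\<bar> \<le> g \<omega> + g' \<omega>"
      using gr[OF h[OF r], of \<omega>] g'r[OF r, of \<omega>] by linarith
  next
    have "(\<integral>\<^sup>+ \<omega>. ennreal (g \<omega> + g' \<omega>) \<partial>?P) = (\<integral>\<^sup>+ \<omega>. ennreal (g \<omega>) \<partial>?P) + (\<integral>\<^sup>+ \<omega>. ennreal (g' \<omega>) \<partial>?P)"
      using g0 g'0 by (simp add: nn_integral_add)
    also have "\<dots> \<le> ennreal (sqrt N * (\<Sum>j\<le>J. chain_term (card L) j)) + ennreal (sqrt N * chain_term (card L) (Suc J))"
      by (intro add_mono gi g'i)
    also have "\<dots> = ennreal (sqrt N * (\<Sum>j\<le>Suc J. chain_term (card L) j))"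
      by (subst ennreal_plus[symmetric])
        (auto simp: algebra_simps chain_term_nonneg intro!: sum_nonneg mult_nonneg_nonneg)
    finally show "(\<integral>\<^sup>+ \<omega>. ennreal (g \<omega> + g' \<omega>) \<partial>?P) \<le> \<dots>" .
  qed (use g0 g'0 in \<open>auto intro: add_nonneg_nonneg\<close>)
qed

lemma prob_cdf_strip:
  assumes H: "H \<in> borel_measurable M" and atomless: "\<And>v. prob {x \<in> space M. H x = v} = 0"
    and ab: "0 \<le> a" "a \<le> b"
  shows "prob {x \<in> space M. a \<le> cdf (distr M borel H) (H x) \<and> cdf (distr M borel H) (H x) < b} \<le> b - a"
proof -
  note H[measurable]
  interpret D: real_distribution "distr M borel H"
    by (intro real_distribution_distr) simp
  have [measurable]: "cdf (distr M borel H) \<in> borel_measurable borel"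
    by (rule D.borel_measurable_cdf)
  have "D.prob {v} = 0" for v
    using atomless[of v] by (simp add: measure_distr vimage_def Int_def conj_commute)
  from D.measure_cdf_strip[OF this ab]
  show ?thesis
    by (subst (asm) measure_distr) (auto simp: vimage_def Int_def conj_commute)
qed

text \<open>Sandwiching an orthant between neighbouring cells of
  the quantile grid also absorbs the difference between weak and strict inequalities.\<close>

lemma orthant_deviation:
  fixes H :: "'l \<Rightarrow> 'a \<Rightarrow> real"
  assumes A0: "A0 \<in> events" and L: "finite L"
    and H: "\<And>l. l \<in> L \<Longrightarrow> H l \<in> borel_measurable M"
    and atomless: "\<And>l v. l \<in> L \<Longrightarrow> prob {x \<in> space M. H l x = v} = 0"
    and N: "1 \<le> N"
  obtains g where "g \<in> borel_measurable (PiM {..<N} (\<lambda>_. M))" "\<And>\<omega>. 0 \<le> g \<omega>"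
    "(\<integral>\<^sup>+ \<omega>. ennreal (g \<omega>) \<partial>PiM {..<N} (\<lambda>_. M)) \<le> ennreal (sqrt N * (chain_const (card L) + 2 * card L))"
    "\<And>\<omega>. \<bar>emp_dev M N A0 \<omega>\<bar> \<le> g \<omega>"
    "\<And>\<omega> t. real N * prob {x \<in> A0. \<forall>l\<in>L. t l \<le> H l x}
        \<le> (\<Sum>j<N. indicator {x \<in> A0. \<forall>l\<in>L. t l < H l x} (\<omega> j)) + g \<omega>"
    "\<And>\<omega> t. (\<Sum>j<N. indicator {x \<in> A0. \<forall>l\<in>L. t l \<le> H l x} (\<omega> j))
        \<le> real N * prob {x \<in> A0. \<forall>l\<in>L. t l < H l x} + g \<omega>"
proof -
  \<comment> \<open>The deepest level the chain may reach. Its mesh is below 2 / N, so bracketing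
    costs less than a constant number of sample points, namely \<open>2 * card L\<close>.\<close>
  obtain J where J: "2 ^ J \<le> N" "N < 2 ^ Suc J"
    using ex_power_ivl1[of 2 N] N by auto
  let ?F = "\<lambda>l. cdf (distr M borel (H l))"
  define V where "V l x = ?F l (H l x)" for l x
  have rd: "real_distribution (distr M borel (H l))" if "l \<in> L" for l
    using H[OF that] by (intro real_distribution_distr) simp
  have V: "V l \<in> borel_measurable M" if "l \<in> L" for l
    unfolding V_def using real_distribution.borel_measurable_cdf[OF rd[OF that]] H[OF that] by measurable
  have strip: "prob {x \<in> space M. a \<le> V l x \<and> V l x < b} \<le> b - a" if "l \<in> L" "0 \<le> a" "a \<le> b" for l a b
    unfolding V_def by (intro prob_cdf_strip H atomless that)
  have mono: "?F l a \<le> ?F l b" if "l \<in> L" "a \<le> b" for l a b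
    using that finite_borel_measure.cdf_nondecreasing[OF real_distribution.finite_borel_measure_M[OF rd]] by blast
  have F01: "0 \<le> ?F l a" "?F l a \<le> 1" if "l \<in> L" for l a
    using finite_borel_measure.cdf_nonneg[OF real_distribution.finite_borel_measure_M[OF rd[OF that]]] real_distribution.cdf_bounded_prob[OF rd[OF that]] by auto
  let ?B = "grid_set A0 L V J" and ?P = "PiM {..<N} (\<lambda>_. M)"
  interpret P: prob_space ?P by (intro prob_space_PiM) unfold_locales
  obtain g where g [measurable]: "g \<in> borel_measurable ?P" and g0: "\<And>\<omega>. 0 \<le> g \<omega>"
    and gr: "\<And>\<omega> r. r \<in> grid_index L J \<Longrightarrow> \<bar>emp_dev M N (?B r) \<omega>\<bar> \<le> g \<omega>"
    and gi: "(\<integral>\<^sup>+ \<omega>. ennreal (g \<omega>) \<partial>?P) \<le> ennreal (sqrt N * (\<Sum>j\<le>J. chain_term (card L) j))"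
    using emp_dev_chaining[where V = V, OF A0 L V strip J(1)] unfolding dev_dominated_def by blast
  let ?d = "real (card L)"
  have dN: "real N * (?d / 2 ^ J) \<le> 2 * ?d"
  proof -
    have "real N \<le> 2 * 2 ^ J"
      using J(2) by (metis less_imp_le of_nat_le_iff of_nat_numeral of_nat_power power_Suc)
    from mult_right_mono[OF this, of ?d] show ?thesis by (simp add: field_simps)
  qed
  have bracket: "\<exists>q r. q \<in> grid_index L J \<and> r \<in> grid_index L J \<and> prob (?B q) \<le> prob (?B r) + ?d / 2 ^ J \<and>
      {x \<in> A0. \<forall>l\<in>L. t l \<le> H l x} \<subseteq> ?B q \<and> ?B r \<subseteq> {x \<in> A0. \<forall>l\<in>L. t l < H l x}" for t
  proof -
    define q where "q = (\<lambda>l\<in>L. nat \<lfloor>?F l (t l) * 2 ^ J\<rfloor>)"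
    \<comment> \<open>One grid step above \<open>q\<close>: the threshold of \<open>r\<close>
      strictly exceeds the cdf at \<open>t l\<close>, so monotonicity of the cdf yields the strict
      inequality \<open>t l < H l x\<close>.\<close>
    define r where "r = (\<lambda>l\<in>L. q l + 1)"
    have q1: "real (q l) \<le> ?F l (t l) * 2 ^ J" "?F l (t l) * 2 ^ J < real (q l) + 1" if "l \<in> L" for l
      using that F01[OF that, of "t l"] by (auto simp: q_def of_nat_floor)
    have "q l \<le> 2 ^ J" if "l \<in> L" for l
    proof -
      have "real (q l) \<le> 1 * 2 ^ J"
        using q1(1)[OF that] F01[OF that, of "t l"] by (meson mult_right_mono order_trans zero_le_numeral zero_le_power)
      then show ?thesis by (metis mult_1 of_nat_le_iff of_nat_numeral of_nat_power)
    qed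
    then have grid: "q \<in> grid_index L J" "r \<in> grid_index L J"
      by (auto simp: grid_index_def q_def r_def le_SucI)
    have sub: "{x \<in> A0. \<forall>l\<in>L. t l \<le> H l x} \<subseteq> ?B q"
    proof (clarsimp simp: grid_set_def)
      fix x l assume l: "l \<in> L" and "\<forall>l\<in>L. t l \<le> H l x"
      then have "?F l (t l) \<le> V l x" unfolding V_def by (intro mono) auto
      then show "real (q l) / 2 ^ J \<le> V l x"
        using q1(1)[OF l] by (simp add: pos_divide_le_eq) (smt (verit) mult_right_mono zero_le_power)
    qed
    have sub': "?B r \<subseteq> {x \<in> A0. \<forall>l\<in>L. t l < H l x}"
    proof (clarsimp simp: grid_set_def)
      fix x l assume l: "l \<in> L" and "\<forall>l\<in>L. real (r l) / 2 ^ J \<le> V l x"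
      then have "real (q l) + 1 \<le> V l x * 2 ^ J" by (auto simp: r_def pos_divide_le_eq add.commute)
      then have "?F l (t l) * 2 ^ J < V l x * 2 ^ J" using q1(2)[OF l] by linarith
      then have "?F l (t l) < ?F l (H l x)" by (simp add: V_def)
      then show "t l < H l x" using mono[OF l, of "H l x" "t l"] by (cases "t l < H l x") auto
    qed
    have "prob (?B q - ?B r) \<le> ?d / 2 ^ J"
      by (intro prob_grid_set_diff_le[where V = V, OF A0 L V strip]) (auto simp: r_def divide_simps)
    moreover have "prob (?B q) \<le> prob (?B r \<union> (?B q - ?B r))"
      using sets_grid_set[where V = V, OF A0 L V] by (intro finite_measure_mono) auto
    moreover have "\<dots> \<le> prob (?B r) + prob (?B q - ?B r)"
      using sets_grid_set[where V = V, OF A0 L V] by (intro measure_Un_le) auto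
    ultimately show ?thesis using grid sub sub' by (intro exI[of _ q] exI[of _ r]) auto
  qed
  have orthant_sets: "{x \<in> A0. \<forall>l\<in>L. t l \<le> H l x} \<in> events" "{x \<in> A0. \<forall>l\<in>L. t l < H l x} \<in> events" for t
  proof -
    note H[measurable] A0[measurable]
    have "{x \<in> A0. \<forall>l\<in>L. t l \<le> H l x} = {x \<in> space M. x \<in> A0 \<and> (\<forall>l\<in>L. t l \<le> H l x)}"
      "{x \<in> A0. \<forall>l\<in>L. t l < H l x} = {x \<in> space M. x \<in> A0 \<and> (\<forall>l\<in>L. t l < H l x)}"
      using sets.sets_into_space[OF A0] by auto
    then show "{x \<in> A0. \<forall>l\<in>L. t l \<le> H l x} \<in> events" "{x \<in> A0. \<forall>l\<in>L. t l < H l x} \<in> events"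
      using L by (simp_all, measurable)
  qed
  have ind: "(\<Sum>j<N. indicator A (\<omega> j) :: real) \<le> (\<Sum>j<N. indicator B (\<omega> j))" if "A \<subseteq> B" for A B :: "'a set" and \<omega>
    using that by (intro sum_mono) (auto simp: indicator_def)
  show ?thesis
  proof (rule that[of "\<lambda>\<omega>. g \<omega> + 2 * ?d"])
    show "(\<integral>\<^sup>+ \<omega>. ennreal (g \<omega> + 2 * ?d) \<partial>?P) \<le> ennreal (sqrt N * (chain_const (card L) + 2 * card L))"
    proof -
      have "(\<integral>\<^sup>+ \<omega>. ennreal (g \<omega> + 2 * ?d) \<partial>?P) = (\<integral>\<^sup>+ \<omega>. ennreal (g \<omega>) \<partial>?P) + ennreal (2 * ?d)"
        using g0 by (simp add: nn_integral_add P.emeasure_space_1)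
      also have "\<dots> \<le> ennreal (sqrt N * chain_const (card L)) + ennreal (sqrt N * (2 * ?d))"
      proof (intro add_mono order_trans[OF gi] ennreal_leI mult_left_mono sum_chain_term_le)
        show "2 * ?d \<le> sqrt N * (2 * ?d)"
          using N mult_right_mono[of 1 "sqrt N" "2 * ?d"] by simp
      qed auto
      also have "\<dots> = ennreal (sqrt N * (chain_const (card L) + 2 * card L))"
        by (subst ennreal_plus[symmetric]) (auto simp: algebra_simps chain_const_nonneg)
      finally show ?thesis .
    qed
    show "\<bar>emp_dev M N A0 \<omega>\<bar> \<le> g \<omega> + 2 * ?d" for \<omega>
    proof -
      have z: "(\<lambda>l\<in>L. 0) \<in> grid_index L J" by (auto simp: grid_index_def)
      \<comment> \<open>Cdf values are nonnegative, so index 0 imposes no constraint, and the count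
        of the whole group falls under the same majorant.\<close>
      have "?B (\<lambda>l\<in>L. 0) = A0" using F01 by (auto simp: grid_set_def V_def)
      with gr[OF z, of \<omega>] show ?thesis by simp
    qed
    fix \<omega> t
    obtain q r where qr: "q \<in> grid_index L J" "r \<in> grid_index L J"
      "prob (?B q) \<le> prob (?B r) + ?d / 2 ^ J"
      "{x \<in> A0. \<forall>l\<in>L. t l \<le> H l x} \<subseteq> ?B q" "?B r \<subseteq> {x \<in> A0. \<forall>l\<in>L. t l < H l x}"
      using bracket by blast
    have "real N * prob (?B q) \<le> real N * (prob (?B r) + ?d / 2 ^ J)"
      using qr by (intro mult_left_mono) auto
    also have "\<dots> \<le> real N * prob (?B r) + 2 * ?d"
      using dN by (simp add: distrib_left)
    finally have *: "real N * prob (?B q) \<le> real N * prob (?B r) + 2 * ?d" .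
    have "real N * prob {x \<in> A0. \<forall>l\<in>L. t l \<le> H l x} \<le> real N * prob (?B q)"
      using qr sets_grid_set[where V = V, OF A0 L V] by (intro mult_left_mono finite_measure_mono) auto
    then show "real N * prob {x \<in> A0. \<forall>l\<in>L. t l \<le> H l x}
        \<le> (\<Sum>j<N. indicator {x \<in> A0. \<forall>l\<in>L. t l < H l x} (\<omega> j)) + (g \<omega> + 2 * ?d)"
      using * gr[OF qr(2), of \<omega>] ind[OF qr(5), of \<omega>] by (simp add: emp_dev_eq)
    have "real N * prob (?B r) \<le> real N * prob {x \<in> A0. \<forall>l\<in>L. t l < H l x}"
      using qr orthant_sets by (intro mult_left_mono finite_measure_mono) auto
    then show "(\<Sum>j<N. indicator {x \<in> A0. \<forall>l\<in>L. t l \<le> H l x} (\<omega> j))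
        \<le> real N * prob {x \<in> A0. \<forall>l\<in>L. t l < H l x} + (g \<omega> + 2 * ?d)"
      using * gr[OF qr(1), of \<omega>] ind[OF qr(4), of \<omega>] by (simp add: emp_dev_eq)
  qed (use g0 in \<open>auto intro: add_nonneg_nonneg\<close>)
qed

end

section \<open>The piecewise linear objective\<close>

text \<open>The sums belong to the groups 1 and -1. The scores \<open>a\<close> and \<open>b\<close>
  already contain the estimated proportions, so the groups differ only in the sign of the
  multiplier.\<close>

definition dual_obj ::
  "'k set \<Rightarrow> nat \<Rightarrow> nat \<Rightarrow> (nat \<Rightarrow> 'k \<Rightarrow> real) \<Rightarrow> (nat \<Rightarrow> 'k \<Rightarrow> real) \<Rightarrow> ('k \<Rightarrow> real) \<Rightarrow> real" where
  "dual_obj I n m a b l =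
     (1 / real n) * (\<Sum>i<n. Max ((\<lambda>k. a i k - l k) ` I)) +
     (1 / real m) * (\<Sum>j<m. Max ((\<lambda>k. b j k + l k) ` I))"

text \<open>With this symmetry a single one-sided optimality condition yields the inequalities in
  both directions.\<close>

lemma dual_obj_swap: "dual_obj I m n b a (\<lambda>k. - l k) = dual_obj I n m a b l"
  by (simp add: dual_obj_def)

text \<open>As long as \<open>h\<close> is below the gap to every competitor, \<open>k\<close>
  remains the maximizer and drags the maximum down by the full amount.\<close>

lemma eventually_Max_decrease:
  fixes c :: "'k \<Rightarrow> real"
  assumes "finite I" "k \<in> I" "\<And>l. l \<in> I - {k} \<Longrightarrow> c l < c k"
  shows "\<forall>\<^sub>F h in at_right 0. Max ((c(k := c k - h)) ` I) \<le> Max (c ` I) - h"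
proof -
  have "\<forall>\<^sub>F h in at_right 0. \<forall>l\<in>I - {k}. h < c k - c l"
    using assms by (intro eventually_ball_finite ballI order_tendstoD(2)[OF tendsto_ident_at]) auto
  then show ?thesis
  proof eventually_elim
    case (elim h)
    have "c k \<le> Max (c ` I)" using assms by auto
    moreover have "c l \<le> Max (c ` I) - h" if "l \<in> I" "l \<noteq> k" for l
    proof -
      have "h < c k - c l" using elim that by auto
      with \<open>c k \<le> Max (c ` I)\<close> show ?thesis by linarith
    qed
    ultimately show ?case
      using assms by (intro Max.boundedI) auto
  qed
qed

text \<open>A coordinate strictly below another one can rise a little unnoticed. Consequently only
  weak maximizers make the objective grow.\<close>

lemma eventually_Max_increase:
  fixes c :: "'k \<Rightarrow> real"
  assumes "finite I" "l \<in> I" "c k < c l"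
  shows "\<forall>\<^sub>F h in at_right 0. Max ((c(k := c k + h)) ` I) \<le> Max (c ` I)"
proof -
  have "\<forall>\<^sub>F h in at_right 0. h < c l - c k"
    using assms by (intro order_tendstoD(2)[OF tendsto_ident_at]) auto
  then show ?thesis
  proof eventually_elim
    case (elim h)
    have le: "c m \<le> Max (c ` I)" if "m \<in> I" for m using assms that by auto
    have "c k + h \<le> Max (c ` I)" using le[OF assms(2)] elim by linarith
    then show ?case
      using assms le by (intro Max.boundedI) auto
  qed
qed

text \<open>The one-sided directional derivatives of the objective along a coordinate axis count the
  sample points at which that coordinate is a strict, respectively weak, maximizer.\<close>

lemma dual_obj_minimizer_le:
  fixes I :: "'k set"
  assumes I: "finite I" and k: "k \<in> I" and min: "\<And>l'. dual_obj I n m a b l \<le> dual_obj I n m a b l'"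
  shows "real (card {i. i < n \<and> (\<forall>p\<in>I - {k}. a i p - l p < a i k - l k)}) / n
    \<le> real (card {j. j < m \<and> (\<forall>p\<in>I - {k}. b j p + l p \<le> b j k + l k)}) / m"
proof -
  let ?S = "{i. i < n \<and> (\<forall>p\<in>I - {k}. a i p - l p < a i k - l k)}"
  let ?W = "{j. j < m \<and> (\<forall>p\<in>I - {k}. b j p + l p \<le> b j k + l k)}"
  \<comment> \<open>Raising the multiplier of \<open>k\<close> lowers the score of \<open>k\<close>
    in the first sample, gaining \<open>h\<close> at each strict maximizer, and raises it in the
    second, losing at most \<open>h\<close> at each weak one. At a minimizer the gain cannot exceed
    the loss.\<close>
  let ?l = "\<lambda>h. l(k := l k + h)"
  have cS: "(\<Sum>i<n. indicator ?S i :: real) = card ?S" and cW: "(\<Sum>j<m. indicator ?W j :: real) = card ?W"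
    unfolding real_of_card by (rule sum.mono_neutral_cong_right; auto)+
  have A: "\<forall>\<^sub>F h in at_right 0. \<forall>i\<in>{..<n}. Max ((\<lambda>p. a i p - ?l h p) ` I)
      \<le> Max ((\<lambda>p. a i p - l p) ` I) - h * indicator ?S i"
  proof (intro eventually_ball_finite ballI)
    fix i assume "i \<in> {..<n}"
    let ?c = "\<lambda>p. a i p - l p"
    have upd: "(\<lambda>p. a i p - ?l h p) = ?c(k := ?c k - h)" for h by auto
    show "\<forall>\<^sub>F h in at_right 0. Max ((\<lambda>p. a i p - ?l h p) ` I) \<le> Max (?c ` I) - h * indicator ?S i"
    proof (cases "i \<in> ?S")
      case True
      then show ?thesis unfolding upd using eventually_Max_decrease[OF I k, of ?c] by simp
    next
      case False
      have "\<forall>\<^sub>F h in at_right 0. (0::real) < h" by (rule eventually_at_right_less)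
      then show ?thesis
      proof eventually_elim
        case (elim h)
        have le: "?c p \<le> Max (?c ` I)" if "p \<in> I" for p using I that by auto
        have "?c k - h \<le> Max (?c ` I)" using le[OF k] elim by linarith
        moreover have "indicator ?S i = (0::real)" using False by (simp add: indicator_def)
        ultimately show ?case
          unfolding upd using I k le by (intro Max.boundedI) auto
      qed
    qed
  qed simp
  have B: "\<forall>\<^sub>F h in at_right 0. \<forall>j\<in>{..<m}. Max ((\<lambda>p. b j p + ?l h p) ` I)
      \<le> Max ((\<lambda>p. b j p + l p) ` I) + h * indicator ?W j"
  proof (intro eventually_ball_finite ballI)
    fix j assume j: "j \<in> {..<m}"
    let ?c = "\<lambda>p. b j p + l p"
    have upd: "(\<lambda>p. b j p + ?l h p) = ?c(k := ?c k + h)" for h by auto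
    show "\<forall>\<^sub>F h in at_right 0. Max ((\<lambda>p. b j p + ?l h p) ` I) \<le> Max (?c ` I) + h * indicator ?W j"
    proof (cases "j \<in> ?W")
      case False
      then have "\<exists>p\<in>I - {k}. \<not> ?c p \<le> ?c k" using j by blast
      then obtain p where p: "p \<in> I" "?c k < ?c p" by (auto simp: not_le)
      show ?thesis unfolding upd using eventually_Max_increase[OF I p] False by simp
    next
      case True
      have "\<forall>\<^sub>F h in at_right 0. (0::real) < h" by (rule eventually_at_right_less)
      then show ?thesis
      proof eventually_elim
        case (elim h)
        have le: "?c p \<le> Max (?c ` I)" if "p \<in> I" for p using I that by auto
        have le': "?c p \<le> Max (?c ` I) + h" if "p \<in> I" for p using le[OF that] elim by linarith
        show ?case
          unfolding upd using True elim I k le[OF k] le'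
          by (intro Max.boundedI) auto
      qed
    qed
  qed simp
  have "\<forall>\<^sub>F h in at_right 0. (0::real) < h" by (rule eventually_at_right_less)
  with A B have "\<forall>\<^sub>F h in at_right 0. 0 < h \<and> h * (real (card ?S) / n) \<le> h * (real (card ?W) / m)"
  proof eventually_elim
    case (elim h)
    have "(\<Sum>i<n. Max ((\<lambda>p. a i p - ?l h p) ` I)) \<le> (\<Sum>i<n. Max ((\<lambda>p. a i p - l p) ` I) - h * indicator ?S i)"
      using elim by (intro sum_mono) auto
    also have "\<dots> = (\<Sum>i<n. Max ((\<lambda>p. a i p - l p) ` I)) - h * card ?S"
      by (simp add: sum_subtractf sum_distrib_left[symmetric] cS cW)
    finally have 1: "(1 / real n) * (\<Sum>i<n. Max ((\<lambda>p. a i p - ?l h p) ` I))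
        \<le> (1 / real n) * ((\<Sum>i<n. Max ((\<lambda>p. a i p - l p) ` I)) - h * card ?S)"
      by (intro mult_left_mono) auto
    have "(\<Sum>j<m. Max ((\<lambda>p. b j p + ?l h p) ` I)) \<le> (\<Sum>j<m. Max ((\<lambda>p. b j p + l p) ` I) + h * indicator ?W j)"
      using elim by (intro sum_mono) auto
    also have "\<dots> = (\<Sum>j<m. Max ((\<lambda>p. b j p + l p) ` I)) + h * card ?W"
      by (simp add: sum.distrib sum_distrib_left[symmetric] cS cW)
    finally have 2: "(1 / real m) * (\<Sum>j<m. Max ((\<lambda>p. b j p + ?l h p) ` I))
        \<le> (1 / real m) * ((\<Sum>j<m. Max ((\<lambda>p. b j p + l p) ` I)) + h * card ?W)"
      by (intro mult_left_mono) auto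
    have "dual_obj I n m a b l \<le> dual_obj I n m a b (?l h)" by (rule min)
    also have "\<dots> \<le> dual_obj I n m a b l + h * (real (card ?W) / m) - h * (real (card ?S) / n)"
      using 1 2 unfolding dual_obj_def by (simp add: algebra_simps)
    finally show ?case using elim by simp
  qed
  then obtain h :: real where "0 < h" "h * (real (card ?S) / n) \<le> h * (real (card ?W) / m)"
    using eventually_happens'[OF trivial_limit_at_right_real] by blast
  then show ?thesis by (rule mult_left_le_imp_le[rotated])
qed

section \<open>Existence of a minimizer when both groups are nonempty\<close>

lemma continuous_on_Max_image:
  fixes f :: "'k \<Rightarrow> 'a::topological_space \<Rightarrow> real"
  assumes "finite I" "I \<noteq> {}" "\<And>k. k \<in> I \<Longrightarrow> continuous_on S (f k)"
  shows "continuous_on S (\<lambda>x. Max ((\<lambda>k. f k x) ` I))"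
  using assms
proof (induction I rule: finite_ne_induct)
  case (insert k I)
  then show ?case by (simp add: continuous_on_max)
qed simp

lemma le_average:
  fixes f :: "nat \<Rightarrow> real"
  assumes "0 < n" "\<And>i. i < n \<Longrightarrow> c \<le> f i"
  shows "c \<le> (1 / real n) * (\<Sum>i<n. f i)"
  using sum_bounded_below[of "{..<n}" c f] assms by (simp add: field_simps)

lemma average_le:
  fixes f :: "nat \<Rightarrow> real"
  assumes "0 < n" "\<And>i. i < n \<Longrightarrow> f i \<le> c"
  shows "(1 / real n) * (\<Sum>i<n. f i) \<le> c"
  using sum_bounded_above[of "{..<n}" f c] assms by (simp add: field_simps)

text \<open>Up to an additive constant shift of \<open>l\<close>, which does not change the objective, a
  minimizer lies in a bounded box.\<close>

lemma dual_obj_has_minimizer: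
  fixes I :: "'k set"
  assumes I: "finite I" "I \<noteq> {}" and n: "0 < n" and m: "0 < m"
  shows "\<exists>l0. \<forall>l. dual_obj I n m a b l0 \<le> dual_obj I n m a b l"
proof -
  let ?F = "dual_obj I n m a b"
  obtain k0 where k0: "k0 \<in> I" using I by blast
  define B where "B = (\<Sum>i<n. \<Sum>k\<in>I. \<bar>a i k\<bar>) + (\<Sum>j<m. \<Sum>k\<in>I. \<bar>b j k\<bar>)"
  have nn: "0 \<le> (\<Sum>i<n. \<Sum>k\<in>I. \<bar>a i k\<bar>)" "0 \<le> (\<Sum>j<m. \<Sum>k\<in>I. \<bar>b j k\<bar>)"
    by (auto intro!: sum_nonneg)
  have aB: "\<bar>a i k\<bar> \<le> B" if "i < n" "k \<in> I" for i k
  proof -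
    have "\<bar>a i k\<bar> \<le> (\<Sum>k\<in>I. \<bar>a i k\<bar>)"
      by (rule member_le_sum[where f = "\<lambda>k. \<bar>a i k\<bar>", OF that(2) _ I(1)]) simp
    also have "\<dots> \<le> (\<Sum>i<n. \<Sum>k\<in>I. \<bar>a i k\<bar>)"
      using that by (intro member_le_sum[where f = "\<lambda>i. \<Sum>k\<in>I. \<bar>a i k\<bar>"]) (auto intro: sum_nonneg)
    finally show ?thesis using nn by (simp add: B_def)
  qed
  have bB: "\<bar>b j k\<bar> \<le> B" if "j < m" "k \<in> I" for j k
  proof -
    have "\<bar>b j k\<bar> \<le> (\<Sum>k\<in>I. \<bar>b j k\<bar>)"
      by (rule member_le_sum[where f = "\<lambda>k. \<bar>b j k\<bar>", OF that(2) _ I(1)]) simp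
    also have "\<dots> \<le> (\<Sum>j<m. \<Sum>k\<in>I. \<bar>b j k\<bar>)"
      using that by (intro member_le_sum[where f = "\<lambda>j. \<Sum>k\<in>I. \<bar>b j k\<bar>"]) (auto intro: sum_nonneg)
    finally show ?thesis using nn by (simp add: B_def)
  qed
  have B0: "0 \<le> B" using nn by (simp add: B_def)
  have Max_ge_comp: "f k \<le> Max (f ` I)" if "k \<in> I" for f :: "'k \<Rightarrow> real" and k
    using I that by auto
  have zero_le: "?F (\<lambda>_. 0) \<le> 2 * B"
  proof -
    have "(1 / real n) * (\<Sum>i<n. Max ((\<lambda>k. a i k - 0) ` I)) \<le> B"
      using I aB by (intro average_le n Max.boundedI) (auto simp: abs_le_iff)
    moreover have "(1 / real m) * (\<Sum>j<m. Max ((\<lambda>k. b j k + 0) ` I)) \<le> B"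
      using I bB by (intro average_le m Max.boundedI) (auto simp: abs_le_iff)
    ultimately show ?thesis unfolding dual_obj_def by linarith
  qed
  \<comment> \<open>With \<open>l k0 = 0\<close>, one of the two sums grows with
    \<open>|l k|\<close> through the component \<open>k\<close>, while the other is bounded below
    through the component \<open>k0\<close>.\<close>
  have coercive: "\<bar>l k\<bar> - 2 * B \<le> ?F l" if "l k0 = 0" "k \<in> I" for l k
  proof (cases "0 \<le> l k")
    case True
    have "- B \<le> (1 / real n) * (\<Sum>i<n. Max ((\<lambda>k. a i k - l k) ` I))"
      using aB[OF _ k0] that by (intro le_average n order_trans[OF _ Max_ge_comp[OF k0]]) (auto simp: abs_le_iff minus_le_iff)
    moreover have "l k - B \<le> (1 / real m) * (\<Sum>j<m. Max ((\<lambda>k. b j k + l k) ` I))"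
      using bB[OF _ that(2)] by (intro le_average m order_trans[OF _ Max_ge_comp[OF that(2)]]) (auto simp: abs_le_iff minus_le_iff)
    ultimately show ?thesis using True unfolding dual_obj_def by linarith
  next
    case False
    have "- l k - B \<le> (1 / real n) * (\<Sum>i<n. Max ((\<lambda>k. a i k - l k) ` I))"
      using aB[OF _ that(2)] by (intro le_average n order_trans[OF _ Max_ge_comp[OF that(2)]]) (auto simp: abs_le_iff minus_le_iff)
    moreover have "- B \<le> (1 / real m) * (\<Sum>j<m. Max ((\<lambda>k. b j k + l k) ` I))"
      using bB[OF _ k0] that by (intro le_average m order_trans[OF _ Max_ge_comp[OF k0]]) (auto simp: abs_le_iff minus_le_iff)
    ultimately show ?thesis using False unfolding dual_obj_def by linarith
  qed
  \<comment> \<open>Outside radius \<open>4 * B\<close> coercivity puts the objective above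
    \<open>2 * B\<close>, hence above its value at 0. The box is compact by Tychonoff, although the
    index type may be infinite.\<close>
  let ?box = "PiE UNIV (\<lambda>_::'k. {- (4 * B)..4 * B})"
  have cont_coord: "continuous_on S (\<lambda>l. l k)" for S :: "('k \<Rightarrow> real) set" and k
    by (intro continuous_on_subset[OF continuous_on_product_coordinates]) auto
  have "continuous_on ?box ?F"
    unfolding dual_obj_def
    by (intro continuous_intros continuous_on_Max_image I cont_coord)
  moreover have "compact ?box"
    using compactin_PiE[of "\<lambda>_::'k. euclidean :: real topology" UNIV "\<lambda>_. {- (4 * B)..4 * B}"]
    by (simp add: euclidean_product_topology compactin_euclidean_iff)
  moreover have zero_in: "(\<lambda>_. 0) \<in> ?box" using B0 by auto
  ultimately obtain l0 where l0: "l0 \<in> ?box" "\<And>l. l \<in> ?box \<Longrightarrow> ?F l0 \<le> ?F l"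
    using continuous_attains_inf[of ?box ?F] by blast
  show ?thesis
  proof (intro exI[of _ l0] allI)
    fix l :: "'k \<Rightarrow> real"
    \<comment> \<open>Normalised at \<open>k0\<close>, and set to 0 outside \<open>I\<close>, where
      the objective does not look, so that only coordinates in \<open>I\<close> can leave the
      box.\<close>
    define l' where "l' k = (if k \<in> I then l k - l k0 else 0)" for k
    have l': "l' k0 = 0" by (simp add: l'_def)
    have "?F l' = ?F l"
    proof -
      have 1: "Max ((\<lambda>k. a i k - l' k) ` I) = Max ((\<lambda>k. a i k - l k) ` I) + l k0" for i
      proof -
        have "(\<lambda>k. a i k - l' k) ` I = (\<lambda>k. (a i k - l k) + l k0) ` I"
          by (intro image_cong) (auto simp: l'_def)
        then show ?thesis by (simp only: Max_add_commute[OF I])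
      qed
      have 2: "Max ((\<lambda>k. b j k + l' k) ` I) = Max ((\<lambda>k. b j k + l k) ` I) + (- l k0)" for j
      proof -
        have "(\<lambda>k. b j k + l' k) ` I = (\<lambda>k. (b j k + l k) + (- l k0)) ` I"
          by (intro image_cong) (auto simp: l'_def)
        then show ?thesis by (simp only: Max_add_commute[OF I])
      qed
      show ?thesis unfolding dual_obj_def 1 2 sum.distrib using n m by (simp add: algebra_simps)
    qed
    moreover have "?F l0 \<le> ?F l'"
    proof (cases "l' \<in> ?box")
      case False
      then obtain k where "l' k \<notin> {- (4 * B)..4 * B}" by blast
      then have k: "\<bar>l' k\<bar> > 4 * B" by auto
      then have "k \<in> I" using B0 by (auto simp: l'_def split: if_splits)
      from coercive[of l' k, OF l' this] k have "2 * B \<le> ?F l'" by linarith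
      then show ?thesis using zero_le l0(2)[OF zero_in] by linarith
    qed (rule l0(2))
    ultimately show "?F l0 \<le> ?F l" by simp
  qed
qed

section \<open>The perturbed sample\<close>

text \<open>Injectivity on pairs makes the blocks disjoint, hence independent, and inside each block
  it makes the law a product again. Coordinates of \<open>T\<close> outside all blocks integrate
  out.\<close>

lemma distr_PiM_blocks:
  fixes f :: "'j \<Rightarrow> 'k \<Rightarrow> 't"
  assumes U: "prob_space U" and J: "J \<noteq> {}"
    and f: "inj_on (\<lambda>(j, k). f j k) (J \<times> I)" "\<And>j k. j \<in> J \<Longrightarrow> k \<in> I \<Longrightarrow> f j k \<in> T"
  shows "distr (PiM T (\<lambda>_. U)) (PiM J (\<lambda>_. PiM I (\<lambda>_. U))) (\<lambda>Z. \<lambda>j\<in>J. \<lambda>k\<in>I. Z (f j k))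
    = PiM J (\<lambda>_. PiM I (\<lambda>_. U))"
proof -
  let ?T = "PiM T (\<lambda>_. U)" and ?I = "PiM I (\<lambda>_. U)"
  interpret T: prob_space ?T by (intro prob_space_PiM U)
  interpret product_prob_space "\<lambda>_::'t. U" T
    using U by (simp add: product_prob_space_def product_prob_space_axioms_def product_sigma_finite_def
        prob_space_imp_sigma_finite)
  have inj: "inj_on (f j) I" if "j \<in> J" for j
    using f(1) that by (auto simp: inj_on_def)
  have X: "(\<lambda>Z. \<lambda>k\<in>I. Z (f j k)) \<in> measurable ?T ?I" if "j \<in> J" for j
    using f(2)[OF that] by (intro measurable_restrict measurable_component_singleton)
  have law: "distr ?T ?I (\<lambda>Z. \<lambda>k\<in>I. Z (f j k)) = ?I" if "j \<in> J" for j
    using distr_PiM_reindex[of T "\<lambda>_. U" "f j" I] U inj f(2) that by auto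
  have "T.indep_vars (\<lambda>_. U) (\<lambda>i Z. Z i) T"
  proof (cases "T = {}")
    case True
    then show ?thesis unfolding T.indep_vars_def T.indep_sets_def by simp
  next
    case False
    have "distr ?T ?T (\<lambda>x. \<lambda>i\<in>T. x i) = distr ?T ?T (\<lambda>x. x)"
      by (intro distr_cong) (auto simp: space_PiM)
    then show ?thesis
      by (subst T.indep_vars_iff_distr_eq_PiM'[OF False])
        (auto simp: distr_id2 intro!: PiM_cong distr_PiM_component[symmetric] U)
  qed
  then have "T.indep_vars (\<lambda>j. PiM (f j ` I) (\<lambda>_. U)) (\<lambda>j Z. restrict (\<lambda>i. Z i) (f j ` I)) J"
  proof (rule T.indep_vars_restrict)
    show "disjoint_family_on (\<lambda>j. f j ` I) J"
      unfolding disjoint_family_on_def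
    proof (intro ballI impI)
      fix j j' assume j: "j \<in> J" "j' \<in> J" "j \<noteq> j'"
      have "f j k \<noteq> f j' k'" if "k \<in> I" "k' \<in> I" for k k'
        using inj_onD[OF f(1), of "(j, k)" "(j', k')"] j that by auto
      then show "f j ` I \<inter> f j' ` I = {}" by auto
    qed
  qed (use f(2) in auto)
  then have "T.indep_vars (\<lambda>_. ?I) (\<lambda>j Z. (\<lambda>\<omega>. \<lambda>k\<in>I. \<omega> (f j k)) (restrict (\<lambda>i. Z i) (f j ` I))) J"
    by (rule T.indep_vars_compose2) (intro measurable_restrict measurable_component_singleton imageI)
  then have "T.indep_vars (\<lambda>_. ?I) (\<lambda>j Z. \<lambda>k\<in>I. Z (f j k)) J"
    by (rule T.indep_vars_cong[THEN iffD1, rotated -1]) (auto simp: fun_eq_iff)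
  then have "distr ?T (PiM J (\<lambda>_. ?I)) (\<lambda>Z. \<lambda>j\<in>J. \<lambda>k\<in>I. Z (f j k))
      = PiM J (\<lambda>j. distr ?T ?I (\<lambda>Z. \<lambda>k\<in>I. Z (f j k)))"
    by (subst (asm) T.indep_vars_iff_distr_eq_PiM'[OF J X])
  also have "\<dots> = PiM J (\<lambda>_. ?I)"
    by (intro PiM_cong law refl)
  finally show ?thesis .
qed

text \<open>Inverse to \<open>grp_idx\<close>: the 0-based position of point \<open>j\<close> within
  its own group, and thus the last index of the perturbations that the objective attaches to
  it.\<close>

definition group_rank :: "(nat \<Rightarrow> 'x \<times> 's) \<Rightarrow> nat \<Rightarrow> nat" where
  "group_rank D j = length (filter (\<lambda>i. snd (D i) = snd (D j)) [0..<j])"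

definition resample ::
  "'k set \<Rightarrow> nat \<Rightarrow> (nat \<Rightarrow> 'x \<times> 's) \<times> ('s \<times> 'k \<times> nat \<Rightarrow> 'z) \<Rightarrow> nat \<Rightarrow> ('x \<times> 's) \<times> ('k \<Rightarrow> 'z)" where
  "resample I N w = (\<lambda>j\<in>{..<N}. (fst w j, \<lambda>k\<in>I. snd w (snd (fst w j), k, group_rank (fst w) j)))"

lemma group_rank_le: "group_rank D j \<le> j"
  unfolding group_rank_def by (rule order_trans[OF length_filter_le]) simp

lemma group_rank_less:
  assumes "i < j" "snd (D i) = snd (D j)"
  shows "group_rank D i < group_rank D j"
proof -
  have "[0..<j] = [0..<i] @ i # [Suc i..<j]"
    using assms by (metis le_add_diff_inverse less_imp_le_nat upt_add_eq_append upt_conv_Cons zero_le)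
  then show ?thesis using assms by (simp add: group_rank_def)
qed

lemma group_rank_inj:
  assumes "snd (D i) = snd (D j)" "group_rank D i = group_rank D j"
  shows "i = j"
  using group_rank_less[of i j D] group_rank_less[of j i D] assms by (cases i j rule: linorder_cases) auto

lemma group_rank_eq_sum: "group_rank D j = (\<Sum>i<j. if snd (D i) = snd (D j) then 1 else 0)"
proof -
  have "group_rank D j = card {i. i < j \<and> snd (D i) = snd (D j)}"
    unfolding group_rank_def
    by (subst distinct_card[symmetric]) (auto intro!: arg_cong[where f = card])
  then show ?thesis by (simp add: sum.If_cases Int_def)
qed

lemma nth_group_rank:
  assumes "j < N"
  shows "grp_idx N D (snd (D j)) ! group_rank D j = j"
    and "group_rank D j < length (grp_idx N D (snd (D j)))"
proof -
  have "[0..<N] = [0..<j] @ j # [Suc j..<N]"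
    using assms by (metis le_add_diff_inverse less_imp_le_nat upt_add_eq_append upt_conv_Cons zero_le)
  then show "grp_idx N D (snd (D j)) ! group_rank D j = j"
    and "group_rank D j < length (grp_idx N D (snd (D j)))"
    by (simp_all add: grp_idx_def group_rank_def nth_append)
qed

text \<open>The position at which a perturbation is read is itself random. It takes finitely many
  values, so measurability reduces to that of its level sets.\<close>

lemma measurable_group_rank:
  assumes Q: "snd \<in> measurable Q (count_space S)" and S: "finite S" and j: "j < N"
  shows "(\<lambda>w. (snd (fst w j), group_rank (fst w) j))
    \<in> measurable (PiM {..<N} (\<lambda>_. Q) \<Otimes>\<^sub>M B) (count_space (S \<times> {..<N}))"
proof -
  let ?M = "PiM {..<N} (\<lambda>_. Q) \<Otimes>\<^sub>M B"
  have lab: "(\<lambda>w. snd (fst w i)) \<in> measurable ?M (count_space S)" if "i < N" for i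
    using that by (intro measurable_compose[OF _ Q] measurable_compose[OF measurable_fst]
        measurable_component_singleton) auto
  have pred: "{w \<in> space ?M. snd (fst w i) = s} \<in> sets ?M" if "i < N" "s \<in> S" for i s
    using measurable_sets[OF lab[OF that(1)], of "{s}"] that by (simp add: vimage_def Int_def conj_commute)
  have labS: "snd (fst w i) \<in> S" if "i < N" "w \<in> space ?M" for i w
    using measurable_space[OF lab[OF that(1)] that(2)] by simp
  have same: "{w \<in> space ?M. snd (fst w i) = snd (fst w j)} \<in> sets ?M" if "i < N" for i
  proof -
    have "{w \<in> space ?M. snd (fst w i) = snd (fst w j)}
        = (\<Union>s\<in>S. {w \<in> space ?M. snd (fst w i) = s} \<inter> {w \<in> space ?M. snd (fst w j) = s})"
      using labS[OF that] labS[OF j] by auto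
    also have "\<dots> \<in> sets ?M"
      using S pred that j by (intro sets.finite_UN sets.Int) auto
    finally show ?thesis .
  qed
  have "(\<lambda>w. \<Sum>i<j. if snd (fst w i) = snd (fst w j) then 1 else 0 :: nat) \<in> measurable ?M (count_space UNIV)"
    using same j by (intro measurable_sum_nat measurable_If) auto
  then have rank: "{w \<in> space ?M. group_rank (fst w) j = r} \<in> sets ?M" for r
    unfolding group_rank_eq_sum
    using measurable_sets[of _ ?M "count_space UNIV" "{r}"] by (simp add: vimage_def Int_def conj_commute)
  show ?thesis
  proof (subst measurable_count_space_eq2)
    have "group_rank D j < N" for D :: "nat \<Rightarrow> 'a \<times> 'b"
      using group_rank_le[of D j] j by linarith
    moreover have "(\<lambda>w. (snd (fst w j), group_rank (fst w) j)) -` {(s, r)} \<inter> space ?M \<in> sets ?M"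
      if "s \<in> S" for s r
    proof -
      have "(\<lambda>w. (snd (fst w j), group_rank (fst w) j)) -` {(s, r)} \<inter> space ?M
          = {w \<in> space ?M. snd (fst w j) = s} \<inter> {w \<in> space ?M. group_rank (fst w) j = r}"
        by auto
      then show ?thesis using pred[OF j that] rank[of r] by auto
    qed
    ultimately show "(\<lambda>w. (snd (fst w j), group_rank (fst w) j)) \<in> space ?M \<rightarrow> S \<times> {..<N} \<and>
      (\<forall>a\<in>S \<times> {..<N}. (\<lambda>w. (snd (fst w j), group_rank (fst w) j)) -` {a} \<inter> space ?M \<in> sets ?M)"
      using labS[OF j] by auto
  qed (use S in auto)
qed

lemma measurable_resample:
  assumes Q: "snd \<in> measurable Q (count_space S)" and S: "finite S"
  shows "resample I N \<in> measurable (PiM {..<N} (\<lambda>_. Q) \<Otimes>\<^sub>M PiM (S \<times> I \<times> {..<N}) (\<lambda>_. U))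
    (PiM {..<N} (\<lambda>_. Q \<Otimes>\<^sub>M PiM I (\<lambda>_. U)))"
  unfolding resample_def
proof (intro measurable_restrict measurable_Pair)
  let ?M = "PiM {..<N} (\<lambda>_. Q) \<Otimes>\<^sub>M PiM (S \<times> I \<times> {..<N}) (\<lambda>_. U)"
  fix j k assume j: "j \<in> {..<N}" and k: "k \<in> I"
  \<comment> \<open>A random coordinate is read by cases over its finitely many possible positions;
    in each case it is a fixed coordinate projection.\<close>
  have "(\<lambda>w. (\<lambda>(s, r) w. snd w (s, k, r)) (snd (fst w j), group_rank (fst w) j) w) \<in> measurable ?M U"
  proof (rule measurable_compose_countable'[where I = "S \<times> {..<N}"])
    fix i assume "i \<in> S \<times> {..<N}"
    then show "(\<lambda>w. (case i of (s, r) \<Rightarrow> \<lambda>w. snd w (s, k, r)) w) \<in> measurable ?M U"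
      using k by (auto intro!: measurable_compose[OF measurable_snd] measurable_component_singleton)
  qed (use measurable_group_rank[OF Q S] j S in \<open>auto intro: countable_finite\<close>)
  then show "(\<lambda>w. snd w (snd (fst w j), k, group_rank (fst w) j)) \<in> measurable ?M U"
    by simp
qed (auto intro!: measurable_compose[OF measurable_fst] measurable_component_singleton)

text \<open>Conditionally on the features, the index of the perturbation attached to sample point \<open>j\<close>
  is a fixed injective function of \<open>j\<close>, so that the perturbed sample is again i.i.d.\<close>

lemma distr_resample:
  assumes Qp: "prob_space Q" and Up: "prob_space U"
    and Q: "snd \<in> measurable Q (count_space S)" and S: "finite S" and I: "finite I" and N: "0 < N"
  shows "distr (PiM {..<N} (\<lambda>_. Q) \<Otimes>\<^sub>M PiM (S \<times> I \<times> {..<N}) (\<lambda>_. U))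
    (PiM {..<N} (\<lambda>_. Q \<Otimes>\<^sub>M PiM I (\<lambda>_. U))) (resample I N)
    = PiM {..<N} (\<lambda>_. Q \<Otimes>\<^sub>M PiM I (\<lambda>_. U))"
proof -
  let ?D = "PiM {..<N} (\<lambda>_. Q)" and ?Z = "PiM (S \<times> I \<times> {..<N}) (\<lambda>_. U)" and ?I = "PiM I (\<lambda>_. U)"
  let ?R = "Q \<Otimes>\<^sub>M ?I"
  interpret Q: prob_space Q by fact
  interpret I: prob_space ?I by (intro prob_space_PiM Up)
  interpret Z: prob_space ?Z by (intro prob_space_PiM Up)
  interpret QI: pair_prob_space Q ?I ..
  interpret PQ: product_sigma_finite "\<lambda>_::nat. Q" by standard
  interpret PR: product_sigma_finite "\<lambda>_::nat. ?R" by standard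
  interpret PI: product_sigma_finite "\<lambda>_::nat. ?I" by standard
  note meas = measurable_resample[OF Q S, of I N U]
  show ?thesis
  proof (rule PR.PiM_eqI)
    fix A :: "nat \<Rightarrow> _" assume A: "\<And>j. j \<in> {..<N} \<Longrightarrow> A j \<in> sets ?R"
    let ?X = "resample I N -` PiE {..<N} A \<inter> space (?D \<Otimes>\<^sub>M ?Z)"
    have PA: "PiE {..<N} A \<in> sets (PiM {..<N} (\<lambda>_. ?R))"
      using A by (intro sets_PiM_I_finite) auto
    have slice: "emeasure ?Z (Pair D -` ?X) = (\<Prod>j<N. emeasure ?I (Pair (D j) -` A j))"
      if D: "D \<in> space ?D" for D
    proof -
      let ?f = "\<lambda>j k. (snd (D j), k, group_rank D j)"
      let ?h = "\<lambda>Z. \<lambda>j\<in>{..<N}. \<lambda>k\<in>I. Z (?f j k)"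
      have Dj: "D j \<in> space Q" if "j < N" for j
        using D that by (auto simp: space_PiM PiE_iff)
      have S': "snd (D j) \<in> S" if "j < N" for j
        using measurable_space[OF Q Dj[OF that]] by simp
      have f: "inj_on (\<lambda>(j, k). ?f j k) ({..<N} \<times> I)"
        by (auto simp: inj_on_def dest: group_rank_inj)
      have rN: "group_rank D j < N" if "j < N" for j
        using group_rank_le[of D j] that by linarith
      have h: "?h \<in> measurable ?Z (PiM {..<N} (\<lambda>_. ?I))"
        using S' rN by (intro measurable_restrict measurable_component_singleton) auto
      have As: "Pair (D j) -` A j \<in> sets ?I" if "j < N" for j
        using A that by (intro sets_Pair1) auto
      have "Pair D -` ?X = ?h -` PiE {..<N} (\<lambda>j. Pair (D j) -` A j) \<inter> space ?Z"
        using D by (auto simp: resample_def space_pair_measure PiE_iff extensional_def)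
      then have "emeasure ?Z (Pair D -` ?X)
          = emeasure (distr ?Z (PiM {..<N} (\<lambda>_. ?I)) ?h) (PiE {..<N} (\<lambda>j. Pair (D j) -` A j))"
        using As by (subst emeasure_distr[OF h]) (auto intro!: sets_PiM_I_finite)
      also have "\<dots> = emeasure (PiM {..<N} (\<lambda>_. ?I)) (PiE {..<N} (\<lambda>j. Pair (D j) -` A j))"
        using N S' rN by (subst distr_PiM_blocks[OF Up _ f]) auto
      also have "\<dots> = (\<Prod>j<N. emeasure ?I (Pair (D j) -` A j))"
        using As by (intro PI.emeasure_PiM) auto
      finally show ?thesis .
    qed
    have "emeasure (distr (?D \<Otimes>\<^sub>M ?Z) (PiM {..<N} (\<lambda>_. ?R)) (resample I N)) (PiE {..<N} A)
        = emeasure (?D \<Otimes>\<^sub>M ?Z) ?X"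
      by (rule emeasure_distr[OF meas PA])
    also have "\<dots> = (\<integral>\<^sup>+ D. emeasure ?Z (Pair D -` ?X) \<partial>?D)"
      by (intro Z.emeasure_pair_measure_alt measurable_sets[OF meas PA])
    also have "\<dots> = (\<integral>\<^sup>+ D. (\<Prod>j<N. emeasure ?I (Pair (D j) -` A j)) \<partial>?D)"
      by (intro nn_integral_cong slice)
    \<comment> \<open>Once the noise is integrated out, the factor of \<open>j\<close> depends on
      \<open>D j\<close> alone, so independence of the features applies.\<close>
    also have "\<dots> = (\<Prod>j<N. \<integral>\<^sup>+ x. emeasure ?I (Pair x -` A j) \<partial>Q)"
      using A by (intro PQ.product_nn_integral_prod I.measurable_emeasure_Pair) auto
    also have "\<dots> = (\<Prod>j<N. emeasure ?R (A j))"
      using A by (intro prod.cong refl I.emeasure_pair_measure_alt[symmetric]) auto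
    finally show "emeasure (distr (?D \<Otimes>\<^sub>M ?Z) (PiM {..<N} (\<lambda>_. ?R)) (resample I N)) (PiE {..<N} A)
      = (\<Prod>j\<in>{..<N}. emeasure ?R (A j))" .
  qed auto
qed

section \<open>Fairness of the plug-in classifier\<close>

lemma prob_space_unif: "u > 0 \<Longrightarrow> prob_space (unif u)"
  unfolding unif_def by (intro prob_space_uniform_measure) auto

lemma sets_unif [simp, measurable_cong]: "sets (unif u) = sets borel"
  by (simp add: unif_def)

lemma emeasure_unif_singleton [simp]: "emeasure (unif u) {v} = 0"
  by (cases "v \<in> {0..u}") (auto simp: unif_def Int_insert_right)

text \<open>Once the other coordinates are fixed, the equation confines \<open>z k\<close> to a
  single point, which is null.\<close>

lemma emeasure_PiM_unif_diff_eq: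
  assumes u: "u > 0" and I: "finite I" "k \<in> I" "l \<in> I" "k \<noteq> l"
  shows "emeasure (PiM I (\<lambda>_. unif u)) {z \<in> space (PiM I (\<lambda>_. unif u)). z k - z l = v} = 0"
proof -
  interpret product_sigma_finite "\<lambda>_. unif u"
    unfolding product_sigma_finite_def by (intro allI prob_space_imp_sigma_finite prob_space_unif u)
  let ?J = "I - {k}"
  let ?P = "PiM I (\<lambda>_. unif u)"
  let ?S = "{z \<in> space ?P. z k - z l = v}"
  have IJ: "I = insert k ?J" using I by auto
  have [measurable]: "(\<lambda>z. z i) \<in> borel_measurable ?P" if "i \<in> I" for i
    using measurable_component_singleton[OF that, of "\<lambda>_. unif u"] by (simp cong: measurable_cong_sets)
  have S [measurable]: "?S \<in> sets ?P"
    using I by measurable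
  have "emeasure ?P ?S = (\<integral>\<^sup>+ z. indicator ?S z \<partial>?P)"
    by simp
  also have "\<dots> = (\<integral>\<^sup>+ x. \<integral>\<^sup>+ y. indicator ?S (x(k := y)) \<partial>unif u \<partial>PiM ?J (\<lambda>_. unif u))"
    using product_nn_integral_insert[of ?J k "indicator ?S"] I IJ S by simp
  also have "\<dots> \<le> (\<integral>\<^sup>+ x. \<integral>\<^sup>+ y. indicator {v + x l} y \<partial>unif u \<partial>PiM ?J (\<lambda>_. unif u))"
    using I by (intro nn_integral_mono) (auto simp: indicator_def)
  also have "\<dots> = 0" by simp
  finally show ?thesis by simp
qed

section \<open>The argmax rule and the indexing of the groups\<close>

lemma argmax_fix_greatest:
  assumes "1 \<le> K"
  shows "argmax_fix K f \<in> {1..K} \<and> (\<forall>j\<in>{1..K}. f j \<le> f (argmax_fix K f))"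
  unfolding argmax_fix_def
proof (rule LeastI_ex)
  have "Max (f ` {1..K}) \<in> f ` {1..K}" using assms by (intro Max_in) auto
  then obtain k where "k \<in> {1..K}" "Max (f ` {1..K}) = f k" by auto
  moreover have "\<forall>j\<in>{1..K}. f j \<le> Max (f ` {1..K})" by simp
  ultimately show "\<exists>k. k \<in> {1..K} \<and> (\<forall>j\<in>{1..K}. f j \<le> f k)" by auto
qed

lemma argmax_fix_strict:
  assumes "k \<in> {1..K}" "\<And>l. l \<in> {1..K} - {k} \<Longrightarrow> f l < f k"
  shows "argmax_fix K f = k"
  using argmax_fix_greatest[of K f] assms by (metis DiffI atLeastAtMost_iff not_le order_trans singletonD)

text \<open>Trades the least-index choice for finitely many comparisons of scores, a form in which
  the event of predicting \<open>k\<close> is visibly measurable.\<close>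

lemma argmax_fix_eq_iff:
  assumes "k \<in> {1..K}"
  shows "argmax_fix K f = k \<longleftrightarrow> (\<forall>j\<in>{1..K}. f j \<le> f k) \<and> (\<forall>i\<in>{1..<k}. \<exists>j\<in>{1..K}. f i < f j)"
proof
  assume "argmax_fix K f = k"
  moreover have "\<exists>j\<in>{1..K}. f i < f j" if "i \<in> {1..<argmax_fix K f}" for i
  proof (rule ccontr)
    assume "\<not> ?thesis"
    then have "i \<in> {1..K} \<and> (\<forall>j\<in>{1..K}. f j \<le> f i)"
      using that argmax_fix_greatest[of K f] assms by (auto simp: not_less)
    then have "argmax_fix K f \<le> i" unfolding argmax_fix_def by (rule Least_le)
    with that show False by simp
  qed
  ultimately show "(\<forall>j\<in>{1..K}. f j \<le> f k) \<and> (\<forall>i\<in>{1..<k}. \<exists>j\<in>{1..K}. f i < f j)"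
    using argmax_fix_greatest[of K f] assms by auto
next
  assume k: "(\<forall>j\<in>{1..K}. f j \<le> f k) \<and> (\<forall>i\<in>{1..<k}. \<exists>j\<in>{1..K}. f i < f j)"
  show "argmax_fix K f = k"
    unfolding argmax_fix_def
  proof (rule Least_equality)
    fix i assume i: "i \<in> {1..K} \<and> (\<forall>j\<in>{1..K}. f j \<le> f i)"
    show "k \<le> i"
    proof (rule ccontr)
      assume "\<not> k \<le> i"
      with i have "i \<in> {1..<k}" by simp
      with k obtain j where "j \<in> {1..K}" "f i < f j" by blast
      with i show False by fastforce
    qed
  qed (use k assms in auto)
qed

lemma grp_idx_nth:
  assumes "i < length (grp_idx N D s)"
  shows "grp_idx N D s ! i < N" "snd (D (grp_idx N D s ! i)) = s"
    "group_rank D (grp_idx N D s ! i) = i"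
proof -
  let ?j = "grp_idx N D s ! i"
  have "?j \<in> set (grp_idx N D s)" using assms by (rule nth_mem)
  then show j: "?j < N" "snd (D ?j) = s" by (auto simp: grp_idx_def)
  have "distinct (grp_idx N D s)" by (simp add: grp_idx_def)
  then show "group_rank D ?j = i"
    using nth_group_rank[OF j(1), of D] assms j(2) by (simp add: nth_eq_iff_index_eq)
qed

text \<open>Rank and list position are mutually inverse bijections, so counts over sample points
  become counts over positions in a group, as in the objective.\<close>

lemma card_grp_idx:
  "card {j. j < N \<and> snd (D j) = s \<and> P (D j) (group_rank D j)}
    = card {i. i < length (grp_idx N D s) \<and> P (D (grp_idx N D s ! i)) i}"
  by (rule bij_betw_same_card[of "group_rank D"], rule bij_betw_byWitness[where f' = "\<lambda>i. grp_idx N D s ! i"])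
    (auto simp: grp_idx_nth nth_group_rank)

lemma abs_ratio_diff_le:
  fixes x n b g :: real
  assumes "0 \<le> x" "x \<le> n" "0 < n" "0 < b" "\<bar>n - b\<bar> \<le> g"
  shows "\<bar>x / b - x / n\<bar> \<le> g / b"
proof -
  have "x / b - x / n = (x / n) * ((n - b) / b)"
    using assms by (simp add: field_simps)
  then have "\<bar>x / b - x / n\<bar> = (x / n) * (\<bar>n - b\<bar> / b)"
    using assms by (simp add: abs_mult abs_divide)
  also have "\<dots> \<le> 1 * (g / b)"
    using assms by (intro mult_mono divide_right_mono) auto
  finally show ?thesis by simp
qed

text \<open>Since \<open>x1 \<le> n1\<close>, replacing the denominator \<open>n1\<close> by \<open>N * p1\<close> costs at most
  \<open>g1 / (N * p1)\<close>, however small \<open>n1\<close> is.\<close>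

lemma ratio_transfer:
  fixes m :: real
  assumes N: "0 < N" and m: "0 < m" "m \<le> p1" "m \<le> p2"
    and n: "0 < n1" "0 < n2" "\<bar>n1 - N * p1\<bar> \<le> g1" "\<bar>n2 - N * p2\<bar> \<le> g2"
    and x: "0 \<le> x1" "x1 \<le> n1" "0 \<le> x2" "x2 \<le> n2"
    and q: "N * q1 \<le> x1 + g1" "x2 \<le> N * q2 + g2" and le: "x1 / n1 \<le> x2 / n2"
  shows "q1 / p1 - q2 / p2 \<le> 2 / (N * m) * (g1 + g2)"
proof -
  have pos: "0 < N * p1" "0 < N * p2" using N m by auto
  have g0: "0 \<le> g1" "0 \<le> g2" using n by linarith+
  have gm: "g1 / (N * p1) \<le> g1 / (N * m)" "g2 / (N * p2) \<le> g2 / (N * m)"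
    using N m g0 by (auto intro!: divide_left_mono mult_left_mono)
  have "q1 / p1 = (N * q1) / (N * p1)" using N by simp
  also have "\<dots> \<le> (x1 + g1) / (N * p1)" using q pos by (intro divide_right_mono) auto
  also have "\<dots> = x1 / (N * p1) + g1 / (N * p1)" by (rule add_divide_distrib)
  \<comment> \<open>The deviation enters twice: once from comparing probability with count, once
    from exchanging the denominator.\<close>
  also have "\<dots> \<le> x1 / n1 + 2 * (g1 / (N * m))"
    using abs_ratio_diff_le[OF x(1,2) n(1) pos(1) n(3)] gm by linarith
  also have "\<dots> \<le> x2 / n2 + 2 * (g1 / (N * m))" using le by simp
  also have "\<dots> \<le> x2 / (N * p2) + g2 / (N * m) + 2 * (g1 / (N * m))"
    using abs_ratio_diff_le[OF x(3,4) n(2) pos(2) n(4)] gm by linarith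
  also have "x2 / (N * p2) \<le> (N * q2 + g2) / (N * p2)" using q pos by (intro divide_right_mono) auto
  also have "\<dots> = q2 / p2 + g2 / (N * p2)" using N by (simp add: add_divide_distrib)
  also have "\<dots> \<le> q2 / p2 + g2 / (N * m)" using gm by simp
  moreover have "2 / (N * m) * (g1 + g2) = 2 * (g1 / (N * m)) + 2 * (g2 / (N * m))"
    by (simp add: add_divide_distrib distrib_left)
  ultimately show ?thesis by linarith
qed

section \<open>The classifier for a fixed labeled sample\<close>

locale plugin_setting =
  fixes Q :: "('x \<times> int) measure" and u m :: real and K N :: nat and ph :: "nat \<Rightarrow> 'x \<Rightarrow> int \<Rightarrow> real"
  assumes prob_Q: "prob_space Q"
    and label: "snd \<in> measurable Q (count_space {-1, 1})"
    and ph [measurable]: "\<And>k s. s \<in> {-1, 1} \<Longrightarrow> (\<lambda>q. ph k (fst q) s) \<in> borel_measurable Q"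
    and K: "1 \<le> K" and N: "1 \<le> N" and u: "0 < u" and m: "0 < m"
    and m_le: "\<And>s. s \<in> {-1, 1} \<Longrightarrow> m \<le> measure Q {q \<in> space Q. snd q = s}"
begin

abbreviation "noise \<equiv> PiM {1..K} (\<lambda>_. unif u)"
abbreviation "R \<equiv> Q \<Otimes>\<^sub>M noise"

sublocale Q: prob_space Q by (rule prob_Q)
sublocale noise: prob_space noise by (intro prob_space_PiM prob_space_unif u)
sublocale R: prob_space R by (rule prob_space_pair[OF prob_Q noise.prob_space_axioms])

definition cell :: "int \<Rightarrow> (('x \<times> int) \<times> (nat \<Rightarrow> real)) set" where
  "cell s = {p \<in> space R. snd (fst p) = s}"

text \<open>Neither the estimated proportion nor the multiplier occurs here; both are moved into the
  threshold. The margins are thus fixed functions, and all dependence on the unlabeled data sits in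
  a parameter over which the deviation bound is uniform.\<close>

definition margin :: "int \<Rightarrow> nat \<Rightarrow> nat \<Rightarrow> ('x \<times> int) \<times> (nat \<Rightarrow> real) \<Rightarrow> real" where
  "margin s k l p = (ph k (fst (fst p)) s + snd p k) - (ph l (fst (fst p)) s + snd p l)"

lemma sets_label: "s \<in> {-1, 1} \<Longrightarrow> {q \<in> space Q. snd q = s} \<in> sets Q"
  using measurable_sets[OF label, of "{s}"] by (simp add: vimage_def Int_def conj_commute)

lemma sets_cell: "s \<in> {-1, 1} \<Longrightarrow> cell s \<in> sets R"
proof -
  assume "s \<in> {-1, 1}"
  moreover have "cell s = fst -` {q \<in> space Q. snd q = s} \<inter> space R"
    by (auto simp: cell_def space_pair_measure)
  ultimately show ?thesis using measurable_sets[OF measurable_fst sets_label] by simp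
qed

lemma prob_cell:
  assumes "s \<in> {-1, 1}"
  shows "measure Q {q \<in> space Q. snd q = s} = measure R (cell s)"
proof -
  have "cell s = {q \<in> space Q. snd q = s} \<times> space noise"
    by (auto simp: cell_def space_pair_measure)
  then show ?thesis
    using sets_label[OF assms] by (simp add: measure_def noise.emeasure_pair_measure_Times noise.emeasure_space_1 del: One_nat_def)
qed

lemma measurable_score:
  assumes "s \<in> {-1, 1}" "k \<in> {1..K}"
  shows "(\<lambda>p. ph k (fst (fst p)) s + snd p k) \<in> borel_measurable R"
proof -
  have "(\<lambda>p. snd p k) \<in> measurable R (unif u)"
    using assms by (intro measurable_compose[OF measurable_snd] measurable_component_singleton)
  then have "(\<lambda>p. snd p k) \<in> borel_measurable R"
    by (simp cong: measurable_cong_sets)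
  moreover have "(\<lambda>p. ph k (fst (fst p)) s) \<in> borel_measurable R"
    using measurable_compose[OF measurable_fst ph[OF assms(1)]] .
  ultimately show ?thesis by (rule borel_measurable_add[rotated])
qed

lemma borel_measurable_margin:
  assumes "s \<in> {-1, 1}" "k \<in> {1..K}" "l \<in> {1..K}"
  shows "margin s k l \<in> borel_measurable R"
  unfolding margin_def by (intro borel_measurable_diff measurable_score assms)

text \<open>For fixed features the margin is a noise difference plus a constant, so atomlessness
  comes from the noise alone, whatever the estimators are.\<close>

lemma margin_atomless:
  assumes s: "s \<in> {-1, 1}" and kl: "k \<in> {1..K}" "l \<in> {1..K}" "k \<noteq> l"
  shows "R.prob {p \<in> space R. margin s k l p = v} = 0"
proof -
  let ?S = "{p \<in> space R. margin s k l p = v}"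
  have "margin s k l \<in> borel_measurable R"
    by (intro borel_measurable_margin s kl)
  then have S: "?S \<in> sets R" by measurable
  have "emeasure R ?S = (\<integral>\<^sup>+ q. emeasure noise (Pair q -` ?S) \<partial>Q)"
    by (rule noise.emeasure_pair_measure_alt[OF S])
  also have "\<dots> = (\<integral>\<^sup>+ q. 0 \<partial>Q)"
  proof (rule nn_integral_cong)
    fix q assume q: "q \<in> space Q"
    have "Pair q -` ?S = {z \<in> space noise. z k - z l = v - (ph k (fst q) s - ph l (fst q) s)}"
      using q by (auto simp: margin_def space_pair_measure)
    then show "emeasure noise (Pair q -` ?S) = 0"
      using emeasure_PiM_unif_diff_eq[OF u _ kl] by simp
  qed
  finally show ?thesis by (simp add: measure_def)
qed

definition weak_cell :: "int \<Rightarrow> nat \<Rightarrow> (nat \<Rightarrow> real) \<Rightarrow> (('x \<times> int) \<times> (nat \<Rightarrow> real)) set" where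
  "weak_cell s k t = {p \<in> cell s. \<forall>l\<in>{1..K} - {k}. t l \<le> margin s k l p}"

definition strict_cell :: "int \<Rightarrow> nat \<Rightarrow> (nat \<Rightarrow> real) \<Rightarrow> (('x \<times> int) \<times> (nat \<Rightarrow> real)) set" where
  "strict_cell s k t = {p \<in> cell s. \<forall>l\<in>{1..K} - {k}. t l < margin s k l p}"

definition controls_dev :: "int \<Rightarrow> nat \<Rightarrow> ((nat \<Rightarrow> ('x \<times> int) \<times> (nat \<Rightarrow> real)) \<Rightarrow> real) \<Rightarrow> bool" where
  "controls_dev s k g \<longleftrightarrow>
    g \<in> borel_measurable (PiM {..<N} (\<lambda>_. R)) \<and> (\<forall>\<omega>. 0 \<le> g \<omega>) \<and>
    (\<integral>\<^sup>+ \<omega>. ennreal (g \<omega>) \<partial>PiM {..<N} (\<lambda>_. R)) \<le> ennreal (sqrt N * (chain_const (K - 1) + 2 * real (K - 1))) \<and>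
    (\<forall>\<omega>. \<bar>emp_dev R N (cell s) \<omega>\<bar> \<le> g \<omega>) \<and>
    (\<forall>\<omega> t. real N * R.prob (weak_cell s k t) \<le> (\<Sum>j<N. indicator (strict_cell s k t) (\<omega> j)) + g \<omega>) \<and>
    (\<forall>\<omega> t. (\<Sum>j<N. indicator (weak_cell s k t) (\<omega> j)) \<le> real N * R.prob (strict_cell s k t) + g \<omega>)"

text \<open>Chosen once per group and class, before any threshold is inserted. It may therefore be
  evaluated at thresholds computed from the data and still be integrated against the i.i.d.
  law.\<close>

definition dev :: "int \<Rightarrow> nat \<Rightarrow> (nat \<Rightarrow> ('x \<times> int) \<times> (nat \<Rightarrow> real)) \<Rightarrow> real" where
  "dev s k = (SOME g. controls_dev s k g)"

lemma controls_dev_dev: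
  assumes s: "s \<in> {-1, 1}" and k: "k \<in> {1..K}"
  shows "controls_dev s k (dev s k)"
proof -
  have meas: "margin s k l \<in> borel_measurable R" if "l \<in> {1..K} - {k}" for l
    using that by (intro borel_measurable_margin s k) auto
  have card: "card ({1..K} - {k}) = K - 1" using k by simp
  have "\<exists>g. controls_dev s k g"
    unfolding controls_dev_def weak_cell_def strict_cell_def
    by (rule R.orthant_deviation[where H = "margin s k" and L = "{1..K} - {k}", OF sets_cell[OF s] _ meas _ N])
      (use margin_atomless[OF s k] card in auto)
  then show ?thesis unfolding dev_def by (rule someI_ex)
qed


lemma dev:
  assumes "s \<in> {-1, 1}" "k \<in> {1..K}"
  shows "dev s k \<in> borel_measurable (PiM {..<N} (\<lambda>_. R))" "0 \<le> dev s k \<omega>"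
    "(\<integral>\<^sup>+ \<omega>. ennreal (dev s k \<omega>) \<partial>PiM {..<N} (\<lambda>_. R)) \<le> ennreal (sqrt N * (chain_const (K - 1) + 2 * real (K - 1)))"
    "\<bar>emp_dev R N (cell s) \<omega>\<bar> \<le> dev s k \<omega>"
    "real N * R.prob (weak_cell s k t) \<le> (\<Sum>j<N. indicator (strict_cell s k t) (\<omega> j)) + dev s k \<omega>"
    "(\<Sum>j<N. indicator (weak_cell s k t) (\<omega> j)) \<le> real N * R.prob (strict_cell s k t) + dev s k \<omega>"
  using controls_dev_dev[OF assms] unfolding controls_dev_def by blast+

definition sample :: "(nat \<Rightarrow> 'x \<times> int) \<times> (int \<times> nat \<times> nat \<Rightarrow> real) \<Rightarrow> nat \<Rightarrow> ('x \<times> int) \<times> (nat \<Rightarrow> real)" where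
  "sample = resample {1..K} N"

abbreviation "data_space \<equiv> PiM {..<N} (\<lambda>_. Q) \<Otimes>\<^sub>M PiM ({-1, 1} \<times> {1..K} \<times> {..<N}) (\<lambda>_. unif u)"

lemma measurable_sample: "sample \<in> measurable data_space (PiM {..<N} (\<lambda>_. R))"
  unfolding sample_def by (intro measurable_resample label) auto

lemma distr_sample: "distr data_space (PiM {..<N} (\<lambda>_. R)) sample = PiM {..<N} (\<lambda>_. R)"
  unfolding sample_def using N by (intro distr_resample prob_Q prob_space_unif u label) auto

text \<open>The resampled noise is restricted to \<open>{1..K}\<close> while the objective reads the
  raw family; the hypothesis on \<open>P\<close> makes the two agree.\<close>

lemma sum_indicator_sample:
  assumes w: "w \<in> space data_space"
    and P: "\<And>x z z'. (\<And>k. k \<in> {1..K} \<Longrightarrow> z k = z' k) \<Longrightarrow> P x z = P x z'"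
  shows "(\<Sum>j<N. indicator {p \<in> cell s. P (fst (fst p)) (snd p)} (sample w j) :: real)
    = card {i. i < length (grp_idx N (fst w) s) \<and>
        P (fst (fst w (grp_idx N (fst w) s ! i))) (\<lambda>k. snd w (s, k, i))}"
proof -
  let ?D = "fst w" and ?Z = "snd w"
  have "(\<Sum>j<N. indicator {p \<in> cell s. P (fst (fst p)) (snd p)} (sample w j) :: real)
      = (\<Sum>j\<in>{j. j < N \<and> snd (?D j) = s \<and> P (fst (?D j)) (\<lambda>k. ?Z (s, k, group_rank ?D j))}. 1)"
  proof (rule sum.mono_neutral_cong_right)
    have eq: "sample w j \<in> {p \<in> cell s. P (fst (fst p)) (snd p)} \<longleftrightarrow>
        snd (?D j) = s \<and> P (fst (?D j)) (\<lambda>k. ?Z (s, k, group_rank ?D j))" if "j < N" for j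
    proof -
      have "sample w j \<in> space R"
        using measurable_space[OF measurable_sample w] that by (auto simp: space_PiM PiE_iff)
      moreover have "P (fst (?D j)) (\<lambda>k\<in>{1..K}. ?Z (s, k, group_rank ?D j)) = P (fst (?D j)) (\<lambda>k. ?Z (s, k, group_rank ?D j))"
        by (rule P) simp
      ultimately show ?thesis
        using that by (auto simp: cell_def sample_def resample_def)
    qed
    show "\<forall>j\<in>{..<N} - {j. j < N \<and> snd (?D j) = s \<and> P (fst (?D j)) (\<lambda>k. ?Z (s, k, group_rank ?D j))}.
        indicator {p \<in> cell s. P (fst (fst p)) (snd p)} (sample w j) = (0::real)"
      using eq by (auto simp: indicator_def simp del: mem_Collect_eq)
    show "indicator {p \<in> cell s. P (fst (fst p)) (snd p)} (sample w j) = (1::real)"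
      if "j \<in> {j. j < N \<and> snd (?D j) = s \<and> P (fst (?D j)) (\<lambda>k. ?Z (s, k, group_rank ?D j))}" for j
      using eq[of j] that by (simp add: indicator_def)
  qed auto
  also have "\<dots> = card {i. i < length (grp_idx N ?D s) \<and>
        P (fst (?D (grp_idx N ?D s ! i))) (\<lambda>k. ?Z (s, k, i))}"
    using card_grp_idx[of N ?D s "\<lambda>x r. P (fst x) (\<lambda>k. ?Z (s, k, r))"] by simp
  finally show ?thesis .
qed


lemma sets_weak_strict_cell:
  assumes s: "s \<in> {-1, 1}" and k: "k \<in> {1..K}"
  shows "weak_cell s k t \<in> sets R" "strict_cell s k t \<in> sets R"
proof -
  have [measurable]: "margin s k l \<in> borel_measurable R" if "l \<in> {1..K} - {k}" for l
    using that by (intro borel_measurable_margin s k) auto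
  have [measurable]: "cell s \<in> sets R" by (rule sets_cell[OF s])
  have "weak_cell s k t = {p \<in> space R. p \<in> cell s \<and> (\<forall>l\<in>{1..K} - {k}. t l \<le> margin s k l p)}"
    "strict_cell s k t = {p \<in> space R. p \<in> cell s \<and> (\<forall>l\<in>{1..K} - {k}. t l < margin s k l p)}"
    by (auto simp: weak_cell_def strict_cell_def cell_def)
  moreover have "{p \<in> space R. p \<in> cell s \<and> (\<forall>l\<in>{1..K} - {k}. t l \<le> margin s k l p)} \<in> sets R"
    by measurable
  moreover have "{p \<in> space R. p \<in> cell s \<and> (\<forall>l\<in>{1..K} - {k}. t l < margin s k l p)} \<in> sets R"
    by measurable
  ultimately show "weak_cell s k t \<in> sets R" "strict_cell s k t \<in> sets R" by simp_all
qed

definition threshold :: "(nat \<Rightarrow> 'x \<times> int) \<Rightarrow> (nat \<Rightarrow> real) \<Rightarrow> int \<Rightarrow> nat \<Rightarrow> nat \<Rightarrow> real" where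
  "threshold D lam s k l = of_int s * (lam k - lam l) / pihat N D s"

lemma score_le_iff:
  assumes "0 < pihat N D s"
  shows "pihat N D s * (ph l x s + z l) - of_int s * lam l \<le> pihat N D s * (ph k x s + z k) - of_int s * lam k
      \<longleftrightarrow> threshold D lam s k l \<le> (ph k x s + z k) - (ph l x s + z l)"
    and "pihat N D s * (ph l x s + z l) - of_int s * lam l < pihat N D s * (ph k x s + z k) - of_int s * lam k
      \<longleftrightarrow> threshold D lam s k l < (ph k x s + z k) - (ph l x s + z l)"
  unfolding threshold_def pos_divide_le_eq[OF assms] pos_divide_less_eq[OF assms]
  by (simp_all add: algebra_simps)

text \<open>Under any tie-breaking rule a strict maximizer is predicted, and a predicted class is a
  weak maximizer.\<close>

lemma class_event_between:
  fixes D lam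
  assumes s: "s \<in> {-1, 1}" and k: "k \<in> {1..K}" and pos: "0 < pihat N D s"
  defines "E \<equiv> {p \<in> space R. snd (fst p) = s \<and> plugin_classifier K N ph D lam (fst (fst p)) s (snd p) = k}"
  shows "R.prob (strict_cell s k (threshold D lam s k)) \<le> R.prob E"
    "R.prob E \<le> R.prob (weak_cell s k (threshold D lam s k))"
proof -
  let ?f = "\<lambda>p l. pihat N D s * (ph l (fst (fst p)) s + snd p l) - of_int s * lam l"
  have g: "plugin_classifier K N ph D lam (fst (fst p)) s (snd p) = argmax_fix K (?f p)" for p
    by (simp add: plugin_classifier_def)
  have f [measurable]: "(\<lambda>p. ?f p l) \<in> borel_measurable R" if "l \<in> {1..K}" for l
    by (intro borel_measurable_diff borel_measurable_times borel_measurable_const measurable_score s that)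
  have [measurable]: "cell s \<in> sets R" by (rule sets_cell[OF s])
  \<comment> \<open>Monotonicity of the measure requires \<open>E\<close> itself to be measurable;
    expanding the argmax into comparisons provides this.\<close>
  have "E = {p \<in> space R. p \<in> cell s \<and> (\<forall>j\<in>{1..K}. ?f p j \<le> ?f p k) \<and> (\<forall>i\<in>{1..<k}. \<exists>j\<in>{1..K}. ?f p i < ?f p j)}"
    unfolding E_def g argmax_fix_eq_iff[OF k] by (auto simp: cell_def)
  also have "\<dots> \<in> sets R"
  proof -
    have [measurable]: "(\<lambda>p. ?f p l) \<in> borel_measurable R" if "l \<in> {1..<k}" for l
      using that k by (intro f) auto
    show ?thesis using k by measurable
  qed
  finally have E: "E \<in> sets R" .
  have "strict_cell s k (threshold D lam s k) \<subseteq> E"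
  proof
    fix p assume p: "p \<in> strict_cell s k (threshold D lam s k)"
    have "argmax_fix K (?f p) = k"
      using p k by (intro argmax_fix_strict) (auto simp: score_le_iff(2)[OF pos] strict_cell_def margin_def)
    then show "p \<in> E" using p by (simp add: E_def g strict_cell_def cell_def)
  qed
  then show "R.prob (strict_cell s k (threshold D lam s k)) \<le> R.prob E"
    by (intro R.finite_measure_mono E)
  have "E \<subseteq> weak_cell s k (threshold D lam s k)"
  proof
    fix p assume p: "p \<in> E"
    then have "\<forall>l\<in>{1..K}. ?f p l \<le> ?f p k"
      using argmax_fix_greatest[OF K, of "?f p"] by (simp add: E_def g)
    then show "p \<in> weak_cell s k (threshold D lam s k)"
      using p by (auto simp: score_le_iff(1)[OF pos] weak_cell_def margin_def cell_def E_def)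
  qed
  then show "R.prob E \<le> R.prob (weak_cell s k (threshold D lam s k))"
    by (intro R.finite_measure_mono sets_weak_strict_cell s k)
qed

lemma cond_class_prob_eq:
  assumes "s \<in> {-1, 1}"
  shows "cond_class_prob Q u K g s k =
    R.prob {p \<in> space R. snd (fst p) = s \<and> g (fst (fst p)) s (snd p) = k} / R.prob (cell s)"
  unfolding cond_class_prob_def prob_cell[OF assms] ..

lemma cond_class_prob_le_1:
  assumes s: "s \<in> {-1, 1}"
  shows "0 \<le> cond_class_prob Q u K g s k" "cond_class_prob Q u K g s k \<le> 1"
proof -
  have "R.prob {p \<in> space R. snd (fst p) = s \<and> g (fst (fst p)) s (snd p) = k} \<le> R.prob (cell s)"
    by (intro R.finite_measure_mono sets_cell s) (auto simp: cell_def)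
  then show "0 \<le> cond_class_prob Q u K g s k" "cond_class_prob Q u K g s k \<le> 1"
    unfolding cond_class_prob_eq[OF s] by (simp_all add: divide_le_eq_1 measure_nonneg zero_less_measure_iff not_less)
qed

lemma fair_objective_eq_dual_obj:
  "fair_objective K N ph D Z lam = dual_obj {1..K} (length (grp_idx N D 1)) (length (grp_idx N D (-1)))
    (\<lambda>i k. pihat N D 1 * (ph k (fst (D (grp_idx N D 1 ! i))) 1 + Z (1, k, i)))
    (\<lambda>j k. pihat N D (-1) * (ph k (fst (D (grp_idx N D (-1) ! j))) (-1) + Z (-1, k, j))) lam"
  by (simp add: fair_objective_def dual_obj_def)

text \<open>First-order optimality transported to the perturbed sample. For \<open>s = -1\<close> it
  is read for the swapped objective, which \<open>- lam\<close> minimizes.\<close>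

lemma empirical_balance:
  assumes w: "w \<in> space data_space" and k: "k \<in> {1..K}"
    and n: "0 < length (grp_idx N (fst w) 1)" "0 < length (grp_idx N (fst w) (-1))"
    and opt: "\<And>l. fair_objective K N ph (fst w) (snd w) lam \<le> fair_objective K N ph (fst w) (snd w) l"
    and s: "s \<in> {-1, 1}"
  shows "(\<Sum>j<N. indicator (strict_cell s k (threshold (fst w) lam s k)) (sample w j)) / length (grp_idx N (fst w) s)
    \<le> (\<Sum>j<N. indicator (weak_cell (- s) k (threshold (fst w) lam (- s) k)) (sample w j)) / length (grp_idx N (fst w) (- s))"
proof -
  let ?D = "fst w" and ?Z = "snd w"
  let ?n = "\<lambda>s. length (grp_idx N ?D s)"
  let ?a = "\<lambda>s i k. pihat N ?D s * (ph k (fst (?D (grp_idx N ?D s ! i))) s + ?Z (s, k, i))"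
  have pos: "0 < pihat N ?D s" if "s \<in> {-1, 1}" for s
    using that n N by (auto simp: pihat_def)
  have strict: "(\<Sum>j<N. indicator (strict_cell s k (threshold ?D lam s k)) (sample w j) :: real)
      = card {i. i < ?n s \<and> (\<forall>p\<in>{1..K} - {k}. ?a s i p - of_int s * lam p < ?a s i k - of_int s * lam k)}"
    if "s \<in> {-1, 1}" for s
  proof -
    let ?P = "\<lambda>x z. \<forall>l\<in>{1..K} - {k}. threshold ?D lam s k l < (ph k x s + z k) - (ph l x s + z l)"
    have "(\<Sum>j<N. indicator {p \<in> cell s. ?P (fst (fst p)) (snd p)} (sample w j) :: real)
        = card {i. i < ?n s \<and> ?P (fst (?D (grp_idx N ?D s ! i))) (\<lambda>k. ?Z (s, k, i))}"
      using k by (intro sum_indicator_sample[OF w, where P = ?P]) auto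
    then show ?thesis
      unfolding score_le_iff(2)[OF pos[OF that], where z = "\<lambda>k. ?Z (s, k, i)" for i] strict_cell_def margin_def .
  qed
  have weak: "(\<Sum>j<N. indicator (weak_cell s k (threshold ?D lam s k)) (sample w j) :: real)
      = card {i. i < ?n s \<and> (\<forall>p\<in>{1..K} - {k}. ?a s i p - of_int s * lam p \<le> ?a s i k - of_int s * lam k)}"
    if "s \<in> {-1, 1}" for s
  proof -
    let ?P = "\<lambda>x z. \<forall>l\<in>{1..K} - {k}. threshold ?D lam s k l \<le> (ph k x s + z k) - (ph l x s + z l)"
    have "(\<Sum>j<N. indicator {p \<in> cell s. ?P (fst (fst p)) (snd p)} (sample w j) :: real)
        = card {i. i < ?n s \<and> ?P (fst (?D (grp_idx N ?D s ! i))) (\<lambda>k. ?Z (s, k, i))}"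
      using k by (intro sum_indicator_sample[OF w, where P = ?P]) auto
    then show ?thesis
      unfolding score_le_iff(1)[OF pos[OF that], where z = "\<lambda>k. ?Z (s, k, i)" for i] weak_cell_def margin_def .
  qed
  have opt1: "dual_obj {1..K} (?n 1) (?n (-1)) (?a 1) (?a (-1)) lam \<le> dual_obj {1..K} (?n 1) (?n (-1)) (?a 1) (?a (-1)) l" for l
    using opt unfolding fair_objective_eq_dual_obj .
  have opt2: "dual_obj {1..K} (?n (-1)) (?n 1) (?a (-1)) (?a 1) (\<lambda>k. - lam k) \<le> dual_obj {1..K} (?n (-1)) (?n 1) (?a (-1)) (?a 1) l" for l
    using opt1[of "\<lambda>k. - l k"] unfolding dual_obj_swap .
  consider "s = 1" | "s = -1" using s by blast
  then show ?thesis
  proof cases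
    case 1
    with dual_obj_minimizer_le[OF _ k opt1] show ?thesis
      using strict[of 1] weak[of "-1"] by simp
  next
    case 2
    with dual_obj_minimizer_le[OF _ k opt2] show ?thesis
      using strict[of "-1"] weak[of 1] by simp
  qed
qed

text \<open>The comparison runs from the class probability of one group to its weak orthant, to the
  empirical strict orthant, by optimality to the empirical weak orthant of the other group, to the
  true strict orthant there, and to the class probability of that group. Each passage between truth
  and sample costs one \<open>dev\<close>.\<close>

lemma unfairness_le:
  assumes w: "w \<in> space data_space"
    and opt: "(\<exists>l0. \<forall>l. fair_objective K N ph (fst w) (snd w) l0 \<le> fair_objective K N ph (fst w) (snd w) l) \<longrightarrow>
      (\<forall>l. fair_objective K N ph (fst w) (snd w) lam \<le> fair_objective K N ph (fst w) (snd w) l)"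
  shows "unfairness Q u K (plugin_classifier K N ph (fst w) lam)
    \<le> 2 / (N * m) * (\<Sum>k\<in>{1..K}. dev 1 k (sample w) + dev (-1) k (sample w))"
proof -
  let ?D = "fst w" and ?g = "plugin_classifier K N ph (fst w) lam"
  let ?n = "\<lambda>s. real (length (grp_idx N ?D s))"
  let ?c = "cond_class_prob Q u K ?g"
  have Nm: "0 < N * m" using N m by simp
  have total: "(\<Sum>j<N. indicator (cell s) (sample w j)) = ?n s" for s
    using sum_indicator_sample[OF w, of "\<lambda>_ _. True" s] by simp
  have dev_n: "\<bar>?n s - N * R.prob (cell s)\<bar> \<le> dev s k (sample w)" if "s \<in> {-1, 1}" "k \<in> {1..K}" for s k
    using dev(4)[OF that, of "sample w"] by (simp add: emp_dev_eq total)
  have m_cell: "m \<le> R.prob (cell s)" if "s \<in> {-1, 1}" for s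
    using m_le[OF that] prob_cell[OF that] by simp
  have gap: "\<bar>?c 1 k - ?c (-1) k\<bar> \<le> 2 / (N * m) * (dev 1 k (sample w) + dev (-1) k (sample w))"
    if k: "k \<in> {1..K}" for k
  proof (cases "0 < ?n 1 \<and> 0 < ?n (-1)")
    case True
    have half: "?c s k - ?c (- s) k \<le> 2 / (N * m) * (dev s k (sample w) + dev (- s) k (sample w))"
      if s: "s \<in> {-1, 1}" for s
    proof -
      have s': "- s \<in> {-1, 1}" using s by auto
      have n: "0 < ?n s" "0 < ?n (- s)" using True s by auto
      have pos: "0 < pihat N ?D s" "0 < pihat N ?D (- s)" using n N by (auto simp: pihat_def)
      have "fair_objective K N ph ?D (snd w) lam \<le> fair_objective K N ph ?D (snd w) l" for l
        using opt dual_obj_has_minimizer[of "{1..K}"] True K unfolding fair_objective_eq_dual_obj by auto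
      note bal = empirical_balance[OF w k _ _ this s]
      have sub: "(\<Sum>j<N. indicator (A j) (sample w j)) \<le> ?n s" if "\<And>j. A j \<subseteq> cell s" for A s
        unfolding total[symmetric] using that by (intro sum_mono) (auto simp: indicator_def)
      show ?thesis
        unfolding cond_class_prob_eq[OF s] cond_class_prob_eq[OF s']
      proof (rule ratio_transfer[OF _ m m_cell[OF s] m_cell[OF s'] n dev_n[OF s k] dev_n[OF s' k]])
        let ?x1 = "\<Sum>j<N. indicator (strict_cell s k (threshold ?D lam s k)) (sample w j) :: real"
        let ?x2 = "\<Sum>j<N. indicator (weak_cell (- s) k (threshold ?D lam (- s) k)) (sample w j) :: real"
        show "?x1 / ?n s \<le> ?x2 / ?n (- s)" using bal True by simp
        show "?x1 \<le> ?n s" by (rule sub) (auto simp: strict_cell_def)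
        show "?x2 \<le> ?n (- s)" by (rule sub) (auto simp: weak_cell_def)
        show "N * R.prob {p \<in> space R. snd (fst p) = s \<and> ?g (fst (fst p)) s (snd p) = k} \<le> ?x1 + dev s k (sample w)"
          by (rule order_trans[OF mult_left_mono dev(5)[OF s k]], rule class_event_between(2)[OF s k pos(1)], simp)
        show "?x2 \<le> N * R.prob {p \<in> space R. snd (fst p) = - s \<and> ?g (fst (fst p)) (- s) (snd p) = k} + dev (- s) k (sample w)"
          by (rule order_trans[OF dev(6)[OF s' k]], rule add_right_mono, rule mult_left_mono,
              rule class_event_between(1)[OF s' k pos(2)], simp)
      qed (use N in \<open>auto intro: sum_nonneg\<close>)
    qed
    show ?thesis using half[of 1] half[of "-1"] by (simp add: add.commute abs_le_iff)
  next
    case False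
    \<comment> \<open>With an empty group the count is off by its whole expectation, so
      \<open>dev\<close> is at least \<open>N * m\<close>, and the right-hand side exceeds the
      trivial bound 1.\<close>
    then obtain s where s: "s \<in> {-1, 1}" "?n s = 0" by auto
    have "N * m \<le> N * R.prob (cell s)" using m_cell[OF s(1)] by (intro mult_left_mono) auto
    also have "\<dots> \<le> dev s k (sample w)" using dev_n[OF s(1) k] s(2) by simp
    also have "\<dots> \<le> dev 1 k (sample w) + dev (-1) k (sample w)"
      using s(1) dev(2)[OF _ k, of 1 "sample w"] dev(2)[OF _ k, of "-1" "sample w"] by auto
    finally have "1 \<le> 1 / (N * m) * (dev 1 k (sample w) + dev (-1) k (sample w))"
      using Nm by (simp add: le_divide_eq)
    moreover have "0 \<le> 1 / (N * m) * (dev 1 k (sample w) + dev (-1) k (sample w))"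
      using Nm dev(2)[OF _ k, of 1 "sample w"] dev(2)[OF _ k, of "-1" "sample w"] by simp
    moreover have "\<bar>?c 1 k - ?c (-1) k\<bar> \<le> 1"
      using cond_class_prob_le_1[of 1 ?g k] cond_class_prob_le_1[of "-1" ?g k] by (auto simp: abs_le_iff)
    ultimately show ?thesis by (simp add: add_divide_distrib)
  qed
  show ?thesis
    unfolding unfairness_def
  proof (rule Max.boundedI)
    fix a assume "a \<in> (\<lambda>k. \<bar>?c 1 k - ?c (-1) k\<bar>) ` {1..K}"
    then obtain k where k: "k \<in> {1..K}" "a = \<bar>?c 1 k - ?c (-1) k\<bar>" by auto
    note gap[OF k(1)]
    also have "2 / (N * m) * (dev 1 k (sample w) + dev (-1) k (sample w))
        \<le> 2 / (N * m) * (\<Sum>k\<in>{1..K}. dev 1 k (sample w) + dev (-1) k (sample w))"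
      using k(1) Nm dev(2) by (intro mult_left_mono member_le_sum) auto
    finally show "a \<le> 2 / (N * m) * (\<Sum>k\<in>{1..K}. dev 1 k (sample w) + dev (-1) k (sample w))"
      using k(2) by simp
  qed (use K in auto)
qed

text \<open>\<open>lam\<close> is arbitrary here, so the integrand may fail to be measurable, but
  its majorant is a function of the i.i.d. sample. The factor 4 * K collects the 2 of the ratio
  comparison, the two groups, and the sum over classes that bounds the maximum.\<close>

lemma nn_integral_unfairness_le:
  assumes opt: "\<And>w. w \<in> space data_space \<Longrightarrow>
      (\<exists>l0. \<forall>l. fair_objective K N ph (fst w) (snd w) l0 \<le> fair_objective K N ph (fst w) (snd w) l) \<longrightarrow>
      (\<forall>l. fair_objective K N ph (fst w) (snd w) (lam w) \<le> fair_objective K N ph (fst w) (snd w) l)"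
  shows "(\<integral>\<^sup>+ w. ennreal (unfairness Q u K (plugin_classifier K N ph (fst w) (lam w))) \<partial>data_space)
    \<le> ennreal (4 * K * (chain_const (K - 1) + 2 * real (K - 1)) / m / sqrt N)"
proof -
  let ?P = "PiM {..<N} (\<lambda>_. R)"
  let ?d = "\<lambda>\<omega>. 2 / (N * m) * (\<Sum>k\<in>{1..K}. dev 1 k \<omega> + dev (-1) k \<omega>)"
  let ?c = "chain_const (K - 1) + 2 * real (K - 1)"
  have c0: "0 \<le> ?c" using chain_const_nonneg by simp
  have Nm: "0 < N * m" using N m by simp
  have [measurable]: "dev 1 k \<in> borel_measurable ?P" "dev (-1) k \<in> borel_measurable ?P" if "k \<in> {1..K}" for k
    using dev(1)[OF _ that] by auto
  have "(\<integral>\<^sup>+ w. ennreal (unfairness Q u K (plugin_classifier K N ph (fst w) (lam w))) \<partial>data_space)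
      \<le> (\<integral>\<^sup>+ w. ennreal (?d (sample w)) \<partial>data_space)"
    by (intro nn_integral_mono ennreal_leI unfairness_le opt)
  also have "\<dots> = (\<integral>\<^sup>+ \<omega>. ennreal (?d \<omega>) \<partial>distr data_space ?P sample)"
    by (intro nn_integral_distr[symmetric] measurable_sample) measurable
  also have "\<dots> = (\<integral>\<^sup>+ \<omega>. ennreal (?d \<omega>) \<partial>?P)"
    by (simp only: distr_sample)
  also have "\<dots> = (\<integral>\<^sup>+ \<omega>. ennreal (2 / (N * m)) * (\<Sum>k\<in>{1..K}. ennreal (dev 1 k \<omega>) + ennreal (dev (-1) k \<omega>)) \<partial>?P)"
  proof (rule nn_integral_cong)
    fix \<omega>
    have "(\<Sum>k\<in>{1..K}. ennreal (dev 1 k \<omega>) + ennreal (dev (-1) k \<omega>)) = (\<Sum>k\<in>{1..K}. ennreal (dev 1 k \<omega> + dev (-1) k \<omega>))"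
      using dev(2) by (intro sum.cong refl ennreal_plus[symmetric]) auto
    also have "\<dots> = ennreal (\<Sum>k\<in>{1..K}. dev 1 k \<omega> + dev (-1) k \<omega>)"
      using dev(2) by (intro sum_ennreal add_nonneg_nonneg) auto
    finally have sum: "(\<Sum>k\<in>{1..K}. ennreal (dev 1 k \<omega>) + ennreal (dev (-1) k \<omega>)) = \<dots>" .
    show "ennreal (?d \<omega>) = ennreal (2 / (N * m)) * (\<Sum>k\<in>{1..K}. ennreal (dev 1 k \<omega>) + ennreal (dev (-1) k \<omega>))"
      unfolding sum using Nm by (intro ennreal_mult') simp
  qed
  also have "\<dots> = ennreal (2 / (N * m)) * (\<Sum>k\<in>{1..K}. (\<integral>\<^sup>+ \<omega>. ennreal (dev 1 k \<omega>) \<partial>?P) + (\<integral>\<^sup>+ \<omega>. ennreal (dev (-1) k \<omega>) \<partial>?P))"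
  proof -
    have "(\<integral>\<^sup>+ \<omega>. (\<Sum>k\<in>{1..K}. ennreal (dev 1 k \<omega>) + ennreal (dev (-1) k \<omega>)) \<partial>?P)
        = (\<Sum>k\<in>{1..K}. \<integral>\<^sup>+ \<omega>. ennreal (dev 1 k \<omega>) + ennreal (dev (-1) k \<omega>) \<partial>?P)"
      by (intro nn_integral_sum) measurable
    also have "\<dots> = (\<Sum>k\<in>{1..K}. (\<integral>\<^sup>+ \<omega>. ennreal (dev 1 k \<omega>) \<partial>?P) + (\<integral>\<^sup>+ \<omega>. ennreal (dev (-1) k \<omega>) \<partial>?P))"
      by (intro sum.cong refl nn_integral_add) measurable
    finally have sum: "(\<integral>\<^sup>+ \<omega>. (\<Sum>k\<in>{1..K}. ennreal (dev 1 k \<omega>) + ennreal (dev (-1) k \<omega>)) \<partial>?P) = \<dots>" .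
    have "(\<lambda>\<omega>. \<Sum>k\<in>{1..K}. ennreal (dev 1 k \<omega>) + ennreal (dev (-1) k \<omega>)) \<in> borel_measurable ?P"
      by measurable
    from nn_integral_cmult[OF this] show ?thesis by (simp only: sum)
  qed
  also have "\<dots> \<le> ennreal (2 / (N * m)) * (\<Sum>k\<in>{1..K}. ennreal (sqrt N * ?c) + ennreal (sqrt N * ?c))"
    by (intro mult_left_mono sum_mono add_mono dev(3)) auto
  also have "\<dots> = ennreal (2 / (N * m)) * ennreal (K * (2 * (sqrt N * ?c)))"
  proof -
    have "(\<Sum>k\<in>{1..K}. ennreal x + ennreal x) = ennreal (K * (2 * x))" if "0 \<le> x" for x :: real
      using that by (simp add: ennreal_plus[symmetric] ennreal_of_nat_eq_real_of_nat ennreal_mult'[symmetric] del: ennreal_plus)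
    from this[of "sqrt N * ?c"] c0 show ?thesis by (simp only: mult_nonneg_nonneg real_sqrt_ge_zero of_nat_0_le_iff)
  qed
  also have "\<dots> = ennreal (2 / (N * m) * (K * (2 * (sqrt N * ?c))))"
    using Nm by (intro ennreal_mult'[symmetric]) simp
  also have "2 / (N * m) * (K * (2 * (sqrt N * ?c))) = 4 * K * ?c / m / sqrt N"
  proof -
    have "2 / (r * r * m) * (K * (2 * (r * c))) = 4 * K * c / m / r" if "0 < r" for r c :: real
      using that m by (simp add: field_simps)
    from this[of "sqrt N" ?c] show ?thesis using N by simp
  qed
  finally show ?thesis .
qed

end

theorem theorem1:
  shows "\<forall>(K::nat) (m::real). K \<ge> 1 \<longrightarrow> m > 0 \<longrightarrow>
    (\<exists>C>0. \<forall>(d::nat) (n::nat) (N::nat) (u::real)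
        (P :: (((nat \<Rightarrow> real) \<times> int) \<times> nat) measure)
        (phat :: nat \<Rightarrow> (nat \<Rightarrow> ((nat \<Rightarrow> real) \<times> int) \<times> nat) \<Rightarrow> (nat \<Rightarrow> real) \<Rightarrow> int \<Rightarrow> real)
        (lam :: (nat \<Rightarrow> ((nat \<Rightarrow> real) \<times> int) \<times> nat) \<times> (nat \<Rightarrow> (nat \<Rightarrow> real) \<times> int)
                 \<times> (int \<times> nat \<times> nat \<Rightarrow> real) \<Rightarrow> nat \<Rightarrow> real).
       prob_space P \<longrightarrow> sets P = sets (XSY_space d K) \<longrightarrow>
       group_prob P 1 > 0 \<longrightarrow> group_prob P (-1) > 0 \<longrightarrow>
       min (group_prob P 1) (group_prob P (-1)) = m \<longrightarrow>
       N \<ge> 1 \<longrightarrow> u > 0 \<longrightarrow>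
       (\<forall>k. (\<lambda>(D, x, s). phat k D x s)
              \<in> borel_measurable (PiM {..<n} (\<lambda>_. P) \<Otimes>\<^sub>M XS_space d)) \<longrightarrow>
       (\<forall>k. (\<lambda>w. lam w k) \<in> borel_measurable (Omega d K n N u P)) \<longrightarrow>
       (\<forall>w \<in> space (Omega d K n N u P).
          (\<exists>l0. \<forall>l. fair_objective K N (\<lambda>k. phat k (fst w)) (fst (snd w)) (snd (snd w)) l0
                      \<le> fair_objective K N (\<lambda>k. phat k (fst w)) (fst (snd w)) (snd (snd w)) l)
          \<longrightarrow> (\<forall>l. fair_objective K N (\<lambda>k. phat k (fst w)) (fst (snd w)) (snd (snd w)) (lam w)
                   \<le> fair_objective K N (\<lambda>k. phat k (fst w)) (fst (snd w)) (snd (snd w)) l)) \<longrightarrow>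
       (\<integral>\<^sup>+ w. ennreal (unfairness (distr P (XS_space d) fst) u K
                  (plugin_classifier K N (\<lambda>k. phat k (fst w)) (fst (snd w)) (lam w)))
          \<partial>Omega d K n N u P)
         \<le> ennreal (C / sqrt (real N)))"
proof (intro allI impI)
  fix K :: nat and m :: real
  assume K: "1 \<le> K" and m: "0 < m"
  \<comment> \<open>Adding 1 turns the nonnegativity of \<open>chain_const\<close> into positivity
    of \<open>C\<close>.\<close>
  define C where "C = 4 * K * (chain_const (K - 1) + 2 * real (K - 1)) / m + 1"
  have C: "0 < C" using chain_const_nonneg[of "K - 1"] m by (simp add: C_def add_nonneg_pos)
  show "\<exists>C>0. \<forall>(d::nat) (n::nat) (N::nat) (u::real)
        (P :: (((nat \<Rightarrow> real) \<times> int) \<times> nat) measure)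
        (phat :: nat \<Rightarrow> (nat \<Rightarrow> ((nat \<Rightarrow> real) \<times> int) \<times> nat) \<Rightarrow> (nat \<Rightarrow> real) \<Rightarrow> int \<Rightarrow> real)
        (lam :: (nat \<Rightarrow> ((nat \<Rightarrow> real) \<times> int) \<times> nat) \<times> (nat \<Rightarrow> (nat \<Rightarrow> real) \<times> int)
                 \<times> (int \<times> nat \<times> nat \<Rightarrow> real) \<Rightarrow> nat \<Rightarrow> real).
       prob_space P \<longrightarrow> sets P = sets (XSY_space d K) \<longrightarrow>
       group_prob P 1 > 0 \<longrightarrow> group_prob P (-1) > 0 \<longrightarrow>
       min (group_prob P 1) (group_prob P (-1)) = m \<longrightarrow>
       N \<ge> 1 \<longrightarrow> u > 0 \<longrightarrow>
       (\<forall>k. (\<lambda>(D, x, s). phat k D x s)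
              \<in> borel_measurable (PiM {..<n} (\<lambda>_. P) \<Otimes>\<^sub>M XS_space d)) \<longrightarrow>
       (\<forall>k. (\<lambda>w. lam w k) \<in> borel_measurable (Omega d K n N u P)) \<longrightarrow>
       (\<forall>w \<in> space (Omega d K n N u P).
          (\<exists>l0. \<forall>l. fair_objective K N (\<lambda>k. phat k (fst w)) (fst (snd w)) (snd (snd w)) l0
                      \<le> fair_objective K N (\<lambda>k. phat k (fst w)) (fst (snd w)) (snd (snd w)) l)
          \<longrightarrow> (\<forall>l. fair_objective K N (\<lambda>k. phat k (fst w)) (fst (snd w)) (snd (snd w)) (lam w)
                   \<le> fair_objective K N (\<lambda>k. phat k (fst w)) (fst (snd w)) (snd (snd w)) l)) \<longrightarrow>
       (\<integral>\<^sup>+ w. ennreal (unfairness (distr P (XS_space d) fst) u K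
                  (plugin_classifier K N (\<lambda>k. phat k (fst w)) (fst (snd w)) (lam w)))
          \<partial>Omega d K n N u P)
         \<le> ennreal (C / sqrt (real N))"
  proof (rule exI[of _ C], intro conjI C allI impI)
    fix d n N :: nat and u :: real and P :: "(((nat \<Rightarrow> real) \<times> int) \<times> nat) measure"
      and phat :: "nat \<Rightarrow> (nat \<Rightarrow> ((nat \<Rightarrow> real) \<times> int) \<times> nat) \<Rightarrow> (nat \<Rightarrow> real) \<Rightarrow> int \<Rightarrow> real"
      and lam :: "(nat \<Rightarrow> ((nat \<Rightarrow> real) \<times> int) \<times> nat) \<times> (nat \<Rightarrow> (nat \<Rightarrow> real) \<times> int)
                 \<times> (int \<times> nat \<times> nat \<Rightarrow> real) \<Rightarrow> nat \<Rightarrow> real"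
    assume P: "prob_space P" and sP: "sets P = sets (XSY_space d K)"
      and min: "min (group_prob P 1) (group_prob P (-1)) = m" and N: "1 \<le> N" and u: "0 < u"
      and phat: "\<forall>k. (\<lambda>(D, x, s). phat k D x s) \<in> borel_measurable (PiM {..<n} (\<lambda>_. P) \<Otimes>\<^sub>M XS_space d)"
      and opt: "\<forall>w \<in> space (Omega d K n N u P).
          (\<exists>l0. \<forall>l. fair_objective K N (\<lambda>k. phat k (fst w)) (fst (snd w)) (snd (snd w)) l0
                      \<le> fair_objective K N (\<lambda>k. phat k (fst w)) (fst (snd w)) (snd (snd w)) l)
          \<longrightarrow> (\<forall>l. fair_objective K N (\<lambda>k. phat k (fst w)) (fst (snd w)) (snd (snd w)) (lam w)
                   \<le> fair_objective K N (\<lambda>k. phat k (fst w)) (fst (snd w)) (snd (snd w)) l)"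
    let ?Q = "distr P (XS_space d) fst"
    let ?T = "PiM {..<n} (\<lambda>_. P)"
    let ?W = "PiM {..<N} (\<lambda>_. ?Q) \<Otimes>\<^sub>M PiM ({-1, 1 :: int} \<times> {1..K} \<times> {..<N}) (\<lambda>_. unif u)"
    have fst_P: "fst \<in> measurable P (XS_space d)"
      unfolding measurable_cong_sets[OF sP refl] XSY_space_def by simp
    have Q: "prob_space ?Q" by (rule prob_space.prob_space_distr[OF P fst_P])
    have label: "snd \<in> measurable ?Q (count_space {-1, 1})"
      unfolding XS_space_def by simp
    have group: "measure ?Q {q \<in> space ?Q. snd q = s} = group_prob P s" if "s \<in> {-1, 1}" for s
    proof -
      have "{q \<in> space ?Q. snd q = s} \<in> sets (XS_space d)"
        using measurable_sets[OF label, of "{s}"] that by (simp add: vimage_def Int_def conj_commute)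
      then show ?thesis
        unfolding group_prob_def using measurable_space[OF fst_P]
        by (subst measure_distr[OF fst_P]) (auto intro!: arg_cong[where f = "measure P"])
    qed
    interpret T: prob_space ?T by (intro prob_space_PiM P)
    interpret W: prob_space ?W
      by (intro prob_space_pair prob_space_PiM Q prob_space_unif u)
    \<comment> \<open>The bound is the same for every labeled sample, so integrating over that
      sample, a probability space, leaves it unchanged.\<close>
    have bound: "(\<integral>\<^sup>+ w. ennreal (unfairness ?Q u K (plugin_classifier K N (\<lambda>k. phat k D) (fst w) (lam (D, w)))) \<partial>?W)
        \<le> ennreal (C / sqrt N)" if D: "D \<in> space ?T" for D
    proof -
      have m_le: "m \<le> measure ?Q {q \<in> space ?Q. snd q = s}" if "s \<in> {-1, 1}" for s
        using min group[OF that] that by auto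
      have ph: "(\<lambda>q. phat k D (fst q) s) \<in> borel_measurable ?Q" if s: "s \<in> {-1, 1}" for k s
      proof -
        have "(\<lambda>q. (D, fst q, s)) \<in> measurable (XS_space d) (?T \<Otimes>\<^sub>M XS_space d)"
          using D s unfolding XS_space_def by (intro measurable_Pair measurable_const) auto
        from measurable_compose[OF this phat[rule_format, of k]] show ?thesis by simp
      qed
      interpret plugin_setting ?Q u m K N "\<lambda>k. phat k D"
        by (rule plugin_setting.intro[OF Q label ph K N u m m_le])
      have "(\<integral>\<^sup>+ w. ennreal (unfairness ?Q u K (plugin_classifier K N (\<lambda>k. phat k D) (fst w) (lam (D, w)))) \<partial>?W)
          \<le> ennreal (4 * K * (chain_const (K - 1) + 2 * real (K - 1)) / m / sqrt N)"
      proof (rule nn_integral_unfairness_le)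
        fix w assume "w \<in> space ?W"
        then have "(D, w) \<in> space (Omega d K n N u P)"
          using D by (simp add: Omega_def space_pair_measure)
        from opt[rule_format, OF this, unfolded fst_conv snd_conv]
        show "(\<exists>l0. \<forall>l. fair_objective K N (\<lambda>k. phat k D) (fst w) (snd w) l0 \<le> fair_objective K N (\<lambda>k. phat k D) (fst w) (snd w) l) \<longrightarrow>
          (\<forall>l. fair_objective K N (\<lambda>k. phat k D) (fst w) (snd w) (lam (D, w)) \<le> fair_objective K N (\<lambda>k. phat k D) (fst w) (snd w) l)"
          by blast
      qed
      also have "\<dots> \<le> ennreal (C / sqrt N)"
        unfolding C_def by (intro ennreal_leI divide_right_mono) auto
      finally show ?thesis .
    qed
    have "(\<integral>\<^sup>+ w. ennreal (unfairness ?Q u K (plugin_classifier K N (\<lambda>k. phat k (fst w)) (fst (snd w)) (lam w))) \<partial>Omega d K n N u P)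
        \<le> (\<integral>\<^sup>+ D. \<integral>\<^sup>+ w. ennreal (unfairness ?Q u K (plugin_classifier K N (\<lambda>k. phat k D) (fst w) (lam (D, w)))) \<partial>?W \<partial>?T)"
      unfolding Omega_def
      by (rule order_trans[OF nn_integral_pair_le[OF W.sigma_finite_measure_axioms]]) simp
    also have "\<dots> \<le> (\<integral>\<^sup>+ D. ennreal (C / sqrt N) \<partial>?T)"
      by (intro nn_integral_mono bound)
    also have "\<dots> = ennreal (C / sqrt N)"
      by (simp add: T.emeasure_space_1)
    finally show "(\<integral>\<^sup>+ w. ennreal (unfairness ?Q u K (plugin_classifier K N (\<lambda>k. phat k (fst w)) (fst (snd w)) (lam w))) \<partial>Omega d K n N u P)
        \<le> ennreal (C / sqrt N)" .
  qed
qed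

end
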